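(* Let $r\ge 2$ be an integer and let $q$ be a complex number with $0<|q|<1$. Let $\mathbf a=(a_1,\dots,a_r)\in\mathbb C^r$ satisfy $a_i-a_j\notin\mathbb Z$ for $1\le i<j\le r$, let $\mathbf b=(b_1,\dots,b_r)\in\mathbb C^r$ be arbitrary, and let $\mathbf m,\mathbf n\in\mathbb Z^r$, $t\in\mathbb Z$. Put $$A=\sum_{i=1}^r a_i,\ B=\sum_{i=1}^r b_i,\ M=\sum_{i=1}^r m_i,\ N=\sum_{i=1}^r n_i,\ M_2=\sum_{i=1}^r m_i^2,\ N_2=\sum_{i=1}^r n_i^2,$$ $$\mathbf a\cdot\mathbf n=\sum_{i=1}^r a_in_i,\quad \mathbf b\cdot\mathbf m=\sum_{i=1}^r b_im_i,\quad m_{\min}=\min_{1\le i\le r}m_i,\quad p=\max\{-1,\,M-N-r-t+1\}.$$ Let $k$ be an integer with $k\ge -m_{\min}$. For $s\ge1$ let $$Q_s=\frac1s\sum_{i=1}^r\Bigg[\sum_{j=0}^{k+n_i}q^{(a_i-n_i-k+j)s}-\sum_{j=0}^{k+m_i-1}q^{(b_i-m_i-k+j)s}\Bigg],\qquad P_s=\frac1s\sum_{i=1}^r\Bigg[\sum_{j=0}^{k+n_i}q^{(-a_i+j)s}-\sum_{j=0}^{k+m_i-1}q^{(1-b_i+j)s}\Bigg],$$ and define $\mathfrak q_{-1}=0$, $\mathfrak q_0=1$, $\mathfrak q_s=\frac1s\sum_{l=1}^s l\,Q_l\,\mathfrak q_{s-l}$ for $s\ge1$, and $\mathfrak p_s=0$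 for $s<0$, $\mathfrak p_0=1$, $\mathfrak p_s=\frac1s\sum_{l=1}^s l\,P_l\,\mathfrak p_{s-l}$ for $s\ge1$. Then $$\sum_{i=1}^r\frac{q^{a_i(1-t)}\prod_{l=1}^r(q^{1-b_l+a_i};q)_{m_l+k}}{(q;q)_{k+n_i}\prod_{l\ne i}(q^{a_i-a_l};q)_{n_l+k+1}}\;{}_{2r}\phi_{2r-1}\left(\begin{array}{c}q^{-k-n_i},\ (q^{b_l-a_i})_{1\le l\le r},\ (q^{a_l-a_i-n_l-k})_{l\ne i}\\ (q^{b_l-a_i-m_l-k})_{1\le l\le r},\ (q^{1-a_i+a_l})_{l\ne i}\end{array}\Big|\ q^{N-M+r-1+t}\right)$$ $$=(-1)^{M-N-r+1}\,q^{k(A-B+M-N)}\,q^{A+\mathbf a\cdot\mathbf n-\mathbf b\cdot\mathbf m+(M_2-N_2+M-N)/2}\;\mathfrak q_p+\mathfrak p_{t-1},$$ where on the left every term with $k+n_i<0$ is taken to be $0$.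
   Context: A logarithm of $q$ is fixed and $q^x=\exp(x\log q)$ for $x\in\mathbb C$. For $n\ge 1$ the $q$-shifted factorial is $(a;q)_0=1$, $(a;q)_n=\prod_{k=0}^{n-1}(1-aq^k)$, $(a;q)_{-n}=\prod_{k=1}^{n}\frac{1}{1-aq^{-k}}$. In particular $1/(q;q)_{-n}=0$ for $n\ge1$. Sums with negative upper limits are read, consistently with $(a;q)_{-n}$, as $\sum_{j=0}^{-1}c_j=0$ and $\sum_{j=0}^{-n-1}c_j=-\sum_{j=-n}^{-1}c_j$ for $n\ge1$ (relevant only for the sums $\sum_{j=0}^{k+n_i}$ when $k+n_i<-1$). The basic hypergeometric function (base $q$ suppressed) is $${}_r\phi_{s}\left(\begin{array}{c}c_1,\dots,c_r\\d_1,\dots,d_s\end{array}\Big|\ z\right)=\sum_{n=0}^\infty\frac{(c_1;q)_n\cdots(c_r;q)_n}{(d_1;q)_n\cdots(d_s;q)_n(q;q)_n}\left[(-1)^nq^{n(n-1)/2}\right]^{1+s-r}z^n ,\qquad r\le s+1;$$ it terminates (so is defined for all $z$) if some upper parameter is $q^{-K}$ with $K\in\{0,1,2,\dots\}$. "$l\neq i$" means $1\le l\le r$, $l\ne i$. The identity is understood for parameter values for which all expressions occurring in it are defined (no vanishing denominators). *)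

theory Defs
  imports "HOL-Analysis.Analysis"
begin

text \<open>Complex powers of \<open>q = exp L\<close> with respect to the chosen logarithm \<open>L\<close> of \<open>q\<close>.\<close>

definition qpow :: "complex \<Rightarrow> complex \<Rightarrow> complex" where
  "qpow L x = exp (x * L)"

text \<open>
  The \<open>q\<close>-shifted factorial for integer index. For a negative index it is undefined when some
  factor \<open>1 - a q\<^sup>-\<^sup>j\<close> vanishes; with \<open>1 / 0 = 0\<close> the value below is then \<open>0\<close>. Hence,
  for either sign of \<open>n\<close>, \<open>qpoch q a n \<noteq> 0\<close> says that the shifted factorial is defined
  and may be divided by.
\<close>

definition qpoch :: "complex \<Rightarrow> complex \<Rightarrow> int \<Rightarrow> complex" where
  "qpoch q a n =
     (if n \<ge> 0 then (\<Prod>j<nat n. 1 - a * q ^ j)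
      else (\<Prod>j=1..nat (- n). 1 / (1 - a / q ^ j)))"

text \<open>
  Only meant for \<open>length cs \<le> length ds + 1\<close>. If the series terminates because of an upper
  parameter \<open>q\<^sup>-\<^sup>K\<close>, all summands with \<open>n > K\<close> have numerator \<open>0\<close> and so are \<open>0\<close>
  whatever the lower parameters are.
\<close>

definition basic_hypergeometric ::
    "complex \<Rightarrow> complex list \<Rightarrow> complex list \<Rightarrow> complex \<Rightarrow> complex" where
  "basic_hypergeometric q cs ds z =
     (\<Sum>n. (\<Prod>c\<leftarrow>cs. qpoch q c (int n)) / ((\<Prod>d\<leftarrow>ds. qpoch q d (int n)) * qpoch q q (int n))
          * ((-1) ^ n * q ^ (n * (n - 1) div 2)) ^ (1 + length ds - length cs) * z ^ n)"

text \<open>The sum of \<open>c j\<close> from \<open>j = 0\<close> to \<open>u\<close>, oriented for negative \<open>u\<close>.\<close>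

definition osum :: "(int \<Rightarrow> complex) \<Rightarrow> int \<Rightarrow> complex" where
  "osum c u = (if u \<ge> -1 then (\<Sum>j=0..u. c j) else - (\<Sum>j=u+1..-1. c j))"

fun newton_rec :: "(nat \<Rightarrow> complex) \<Rightarrow> nat \<Rightarrow> complex" where
  "newton_rec S s =
     (if s = 0 then 1
      else 1 / of_nat s * (\<Sum>l=1..s. of_nat l * S l * newton_rec S (s - l)))"

declare newton_rec.simps [simp del]

definition newton_seq :: "(nat \<Rightarrow> complex) \<Rightarrow> int \<Rightarrow> complex" where
  "newton_seq S s = (if s < 0 then 0 else newton_rec S (nat s))"

definition Q_sum ::
  "complex \<Rightarrow> nat \<Rightarrow> int \<Rightarrow> (nat \<Rightarrow> complex) \<Rightarrow> (nat \<Rightarrow> complex) \<Rightarrow> (nat \<Rightarrow> int) \<Rightarrow> (nat \<Rightarrow> int)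
    \<Rightarrow> nat \<Rightarrow> complex" where
  "Q_sum L r k a b m n s = 1 / of_nat s *
     (\<Sum>i=1..r.
        osum (\<lambda>j. qpow L ((a i - of_int (n i) - of_int k + of_int j) * of_nat s)) (k + n i)
      - osum (\<lambda>j. qpow L ((b i - of_int (m i) - of_int k + of_int j) * of_nat s)) (k + m i - 1))"

definition P_sum ::
  "complex \<Rightarrow> nat \<Rightarrow> int \<Rightarrow> (nat \<Rightarrow> complex) \<Rightarrow> (nat \<Rightarrow> complex) \<Rightarrow> (nat \<Rightarrow> int) \<Rightarrow> (nat \<Rightarrow> int)
    \<Rightarrow> nat \<Rightarrow> complex" where
  "P_sum L r k a b m n s = 1 / of_nat s *
     (\<Sum>i=1..r.
        osum (\<lambda>j. qpow L ((- a i + of_int j) * of_nat s)) (k + n i)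
      - osum (\<lambda>j. qpow L ((1 - b i + of_int j) * of_nat s)) (k + m i - 1))"

definition upper_params ::
  "complex \<Rightarrow> nat \<Rightarrow> int \<Rightarrow> (nat \<Rightarrow> complex) \<Rightarrow> (nat \<Rightarrow> complex) \<Rightarrow> (nat \<Rightarrow> int) \<Rightarrow> nat
    \<Rightarrow> complex list" where
  "upper_params L r k a b n i =
     qpow L (of_int (- k - n i))
     # [qpow L (b l - a i). l \<leftarrow> [1..<r+1]]
     @ [qpow L (a l - a i - of_int (n l) - of_int k). l \<leftarrow> [1..<r+1], l \<noteq> i]"

definition lower_params ::
  "complex \<Rightarrow> nat \<Rightarrow> int \<Rightarrow> (nat \<Rightarrow> complex) \<Rightarrow> (nat \<Rightarrow> complex) \<Rightarrow> (nat \<Rightarrow> int) \<Rightarrow> nat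
    \<Rightarrow> complex list" where
  "lower_params L r k a b m i =
     [qpow L (b l - a i - of_int (m l) - of_int k). l \<leftarrow> [1..<r+1]]
     @ [qpow L (1 - a i + a l). l \<leftarrow> [1..<r+1], l \<noteq> i]"

end

theory Submission
  imports Defs
begin

text \<open>The identity is the residue theorem for the rational function
  \<open>f(x) = \<Prod>\<^sub>l (q\<^bsup>1-b\<^sub>l\<^esup> x; q)\<^bsub>m\<^sub>l+k\<^esub> / \<Prod>\<^sub>l (q\<^bsup>-a\<^sub>l\<^esup> x; q)\<^bsub>n\<^sub>l+k+1\<^esub>\<close>, multiplied by
  \<open>x\<^bsup>-t\<^esup>\<close>. By the choice of \<open>k\<close> all numerators are polynomials, and the finite nonzero poles are at most
  simple and lie at \<open>q\<^bsup>a\<^sub>i-s\<^esup>\<close> with \<open>0 \<le> s \<le> k + n\<^sub>i\<close>. Up to sign, the residue there is the prefactor of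
  the \<open>i\<close>-th summand times the \<open>s\<close>-th term of its hypergeometric series
  (\<open>residue_eq_series_term\<close>); a summand with \<open>k + n\<^sub>i < 0\<close> has no poles.

  The residue at \<open>0\<close> is the coefficient of \<open>x\<^bsup>t-1\<^esup>\<close> in the Taylor series of \<open>f\<close>. The logarithm of
  \<open>f\<close> has the coefficients \<open>P\<^sub>s\<close>, so by Newton's identities this is the last term on the right
  (\<open>newton_seq_P_sum\<close>). At infinity, \<open>f\<close> is a leading coefficient times \<open>x\<^bsup>M-N-r\<^esup>\<close> times a
  quotient of the same shape in \<open>1/x\<close>, whose logarithm has the coefficients \<open>Q\<^sub>s\<close>; minus the
  coefficient of \<open>x\<^bsup>t-1\<^esup>\<close> there is the other term (\<open>leading_coefficient\<close>, \<open>newton_seq_Q_sum\<close>).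

  The residue theorem itself is needed only for quotients of products of linear factors, and it is
  proved algebraically (\<open>residue_sum_eq_coeff_jump\<close>). As sequences in \<open>t\<close>, the residue sum and
  the difference of the expansions at \<open>0\<close> and at infinity obey the same two-term recurrence whenever a
  linear factor is added or removed. Induction on the poles, and then on the zeros, reduces the claim
  to quotients with at most one factor.\<close>

section \<open>Residues of a quotient of products of linear factors\<close>

definition int_coeff :: "complex fps \<Rightarrow> int \<Rightarrow> complex" where
  "int_coeff F s = (if s < 0 then 0 else fps_nth F (nat s))"

definition linear_quotient :: "'i set \<Rightarrow> ('i \<Rightarrow> complex) \<Rightarrow> 'j set \<Rightarrow> ('j \<Rightarrow> complex) \<Rightarrow> complex fps" where
  "linear_quotient I d J c =
     (\<Prod>i\<in>I. 1 - fps_const (d i) * fps_X) * (\<Prod>j\<in>J. inverse (1 - fps_const (c j) * fps_X))"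

text \<open>Indexing coefficients by \<open>int\<close>, with value \<open>0\<close> below the start of the series, makes this
  recurrence hold for every \<open>s\<close>, including \<open>s = 0\<close>. All comparisons below rest on such
  two-term recurrences.\<close>

lemma int_coeff_linear_factor:
  "int_coeff ((1 - fps_const d * fps_X) * F) s = int_coeff F s - d * int_coeff F (s - 1)"
proof -
  have "(1 - fps_const d * fps_X) * F = F - fps_const d * (fps_X * F)"
    by (simp add: algebra_simps)
  then show ?thesis
    by (auto simp: int_coeff_def nat_diff_distrib)
qed

lemma linear_quotient_insert_num:
  assumes "finite I" "x \<notin> I"
  shows "linear_quotient (insert x I) d J c = (1 - fps_const (d x) * fps_X) * linear_quotient I d J c"
  using assms by (simp add: linear_quotient_def mult.assoc)

lemma linear_quotient_insert_den:
  assumes "finite J" "y \<notin> J"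
  shows "linear_quotient I d J c = (1 - fps_const (c y) * fps_X) * linear_quotient I d (insert y J) c"
proof -
  have "inverse (1 - fps_const (c y) * fps_X) * (1 - fps_const (c y) * fps_X) = 1"
    by (rule inverse_mult_eq_1) simp
  then show ?thesis
    using assms by (simp add: linear_quotient_def mult_ac)
qed

text \<open>The coefficient of \<open>x\<^sup>t\<close> in the expansion of
  \<open>f(x) = \<Prod>\<^sub>i (1 - d\<^sub>i x) / \<Prod>\<^sub>j (1 - c\<^sub>j x)\<close> at infinity. It comes from
  \<open>1 - d x = (- d x) (1 - d\<^sup>-\<^sup>1 x\<^sup>-\<^sup>1)\<close>: up to its leading coefficient and a power of \<open>x\<close>,
  \<open>f\<close> is the same kind of quotient in the variable \<open>1/x\<close>, with inverted parameters.\<close>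

definition coeff_at_infinity :: "'i set \<Rightarrow> ('i \<Rightarrow> complex) \<Rightarrow> 'j set \<Rightarrow> ('j \<Rightarrow> complex) \<Rightarrow> int \<Rightarrow> complex" where
  "coeff_at_infinity I d J c t = (\<Prod>i\<in>I. - d i) / (\<Prod>j\<in>J. - c j)
     * int_coeff (linear_quotient I (\<lambda>i. inverse (d i)) J (\<lambda>j. inverse (c j))) (int (card I) - int (card J) - t)"

text \<open>Coefficient of \<open>x\<^sup>t\<close> in the expansion of \<open>f\<close> at \<open>0\<close> minus that in its expansion at infinity. This
  is the combined contribution of \<open>0\<close> and \<open>\<infinity>\<close> to the sum of all residues of
  \<open>f(x) x\<^bsup>-t-1\<^esup>\<close>.\<close>

definition coeff_jump :: "'i set \<Rightarrow> ('i \<Rightarrow> complex) \<Rightarrow> 'j set \<Rightarrow> ('j \<Rightarrow> complex) \<Rightarrow> int \<Rightarrow> complex" where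
  "coeff_jump I d J c t = int_coeff (linear_quotient I d J c) t - coeff_at_infinity I d J c t"

text \<open>Multiplication by \<open>1 - d x\<close> acts on the two expansions in the same way, although at infinity the
  factor is split as \<open>(- d x) (1 - d\<^sup>-\<^sup>1 x\<^sup>-\<^sup>1)\<close> and shifts the degree by one. Hence both the
  expansion at infinity and the jump obey the recurrence of \<open>int_coeff_linear_factor\<close>.\<close>

lemma coeff_at_infinity_insert_num:
  assumes "finite I" "x \<notin> I" "d x \<noteq> 0"
  shows "coeff_at_infinity (insert x I) d J c t = coeff_at_infinity I d J c t - d x * coeff_at_infinity I d J c (t - 1)"
proof -
  have alg: "- w * P / D * (u - inverse w * v) = P / D * v - w * (P / D * u)"
    if "w \<noteq> 0" for w P D u v :: complex
    using that by (cases "D = 0") (simp_all add: field_simps)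
  have *: "int (Suc (card I)) - int (card J) - t = (int (card I) - int (card J) - t) + 1"
       "int (card I) - int (card J) - (t - 1) = (int (card I) - int (card J) - t) + 1" by simp_all
  show ?thesis
    unfolding coeff_at_infinity_def linear_quotient_insert_num[OF assms(1,2)] int_coeff_linear_factor
      prod.insert[OF assms(1,2)] card_insert_disjoint[OF assms(1,2)] * add_diff_cancel_right'
    by (rule alg[OF assms(3)])
qed

lemma coeff_at_infinity_insert_den:
  assumes "finite J" "y \<notin> J" "c y \<noteq> 0"
  shows "coeff_at_infinity I d J c t = coeff_at_infinity I d (insert y J) c t - c y * coeff_at_infinity I d (insert y J) c (t - 1)"
proof -
  have alg: "P / D * (v - inverse w * u) = P / (- w * D) * u - w * (P / (- w * D) * v)"
    if "w \<noteq> 0" for w P D u v :: complex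
    using that by (cases "D = 0") (simp_all add: field_simps)
  have *: "int (card I) - int (card J) - t = (int (card I) - int (Suc (card J)) - t) + 1"
       "int (card I) - int (Suc (card J)) - (t - 1) = (int (card I) - int (Suc (card J)) - t) + 1" by simp_all
  show ?thesis
    unfolding coeff_at_infinity_def linear_quotient_insert_den[OF assms(1,2)] int_coeff_linear_factor
      prod.insert[OF assms(1,2)] card_insert_disjoint[OF assms(1,2)] * add_diff_cancel_right'
    by (rule alg[OF assms(3)])
qed

lemma coeff_jump_insert_num:
  assumes "finite I" "x \<notin> I" "d x \<noteq> 0"
  shows "coeff_jump (insert x I) d J c t = coeff_jump I d J c t - d x * coeff_jump I d J c (t - 1)"
  unfolding coeff_jump_def coeff_at_infinity_insert_num[of I x d, OF assms] linear_quotient_insert_num[OF assms(1,2)]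
    int_coeff_linear_factor
  by (simp add: algebra_simps)

lemma coeff_jump_insert_den:
  assumes "finite J" "y \<notin> J" "c y \<noteq> 0"
  shows "coeff_jump I d J c t = coeff_jump I d (insert y J) c t - c y * coeff_jump I d (insert y J) c (t - 1)"
  unfolding coeff_jump_def coeff_at_infinity_insert_den[of J y c, OF assms] linear_quotient_insert_den[OF assms(1,2)]
    int_coeff_linear_factor
  by (simp add: algebra_simps)

text \<open>Minus the sum of the residues of \<open>f(x) x\<^bsup>-t-1\<^esup>\<close> at the simple poles \<open>x = 1/c\<^sub>j\<close>, computed
  factor by factor.\<close>

definition residue_sum :: "'i set \<Rightarrow> ('i \<Rightarrow> complex) \<Rightarrow> 'j set \<Rightarrow> ('j \<Rightarrow> complex) \<Rightarrow> int \<Rightarrow> complex" where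
  "residue_sum I d J c t =
     (\<Sum>j\<in>J. c j powi t * (\<Prod>i\<in>I. 1 - d i / c j) / (\<Prod>j'\<in>J - {j}. 1 - c j' / c j))"

text \<open>At the pole \<open>1/c\<^sub>j\<close> the factor \<open>1 - d x\<close> takes the value \<open>1 - d/c\<^sub>j\<close>, and division by
  \<open>c\<^sub>j\<close> lowers \<open>t\<close> by one: the residue sums obey the same recurrence as the coefficients.\<close>

lemma residue_sum_insert_num:
  assumes "finite I" "x \<notin> I" "\<And>j. j \<in> J \<Longrightarrow> c j \<noteq> 0"
  shows "residue_sum (insert x I) d J c t = residue_sum I d J c t - d x * residue_sum I d J c (t - 1)"
  unfolding residue_sum_def sum_distrib_left sum_subtractf[symmetric]
proof (rule sum.cong[OF refl])
  fix j assume j: "j \<in> J"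
  have alg: "y * ((1 - e / w) * P) / D = y * P / D - e * (y / w * P / D)"
    if "w \<noteq> 0" for e w y P D :: complex
    using that by (cases "D = 0") (simp_all add: field_simps)
  have "c j powi (t - 1) = c j powi t / c j"
    using assms(3)[OF j] by (simp add: power_int_diff)
  then show "c j powi t * (\<Prod>i\<in>insert x I. 1 - d i / c j) / (\<Prod>j'\<in>J - {j}. 1 - c j' / c j)
     = c j powi t * (\<Prod>i\<in>I. 1 - d i / c j) / (\<Prod>j'\<in>J - {j}. 1 - c j' / c j)
     - d x * (c j powi (t - 1) * (\<Prod>i\<in>I. 1 - d i / c j) / (\<Prod>j'\<in>J - {j}. 1 - c j' / c j))"
    unfolding prod.insert[OF assms(1,2)] using alg[OF assms(3)[OF j]] by simp
qed

text \<open>The factor \<open>1 - c\<^sub>y x\<close> cancels the pole at \<open>1/c\<^sub>y\<close> and leaves the other residues as they are for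
  the smaller family.\<close>

lemma residue_sum_insert_den:
  assumes "finite J" "y \<notin> J" "inj_on c (insert y J)" "\<And>j. j \<in> insert y J \<Longrightarrow> c j \<noteq> 0"
  shows "residue_sum I d J c t = residue_sum I d (insert y J) c t - c y * residue_sum I d (insert y J) c (t - 1)"
proof -
  let ?T = "\<lambda>K t j. c j powi t * (\<Prod>i\<in>I. 1 - d i / c j) / (\<Prod>j'\<in>K - {j}. 1 - c j' / c j)"
  have "residue_sum I d (insert y J) c t - c y * residue_sum I d (insert y J) c (t - 1)
      = (\<Sum>j\<in>insert y J. ?T (insert y J) t j - c y * ?T (insert y J) (t - 1) j)"
    by (simp only: residue_sum_def sum_distrib_left sum_subtractf)
  also have "\<dots> = (\<Sum>j\<in>insert y J. (1 - c y / c j) * ?T (insert y J) t j)"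
  proof (rule sum.cong[OF refl])
    fix j assume j: "j \<in> insert y J"
    have alg: "u * P / D - e * (u / w * P / D) = (1 - e / w) * (u * P / D)" for e w u P D :: complex
      by (subst left_diff_distrib) (simp add: mult_ac)
    have "c j powi (t - 1) = c j powi t / c j"
      using assms(4)[OF j] by (simp add: power_int_diff)
    then show "?T (insert y J) t j - c y * ?T (insert y J) (t - 1) j = (1 - c y / c j) * ?T (insert y J) t j"
      using alg by simp
  qed
  also have "\<dots> = (\<Sum>j\<in>J. (1 - c y / c j) * ?T (insert y J) t j)"
    using assms by simp
  also have "\<dots> = (\<Sum>j\<in>J. ?T J t j)"
  proof (rule sum.cong[OF refl])
    fix j assume j: "j \<in> J"
    have alg: "z * (u / (z * D)) = u / D" if "z \<noteq> 0" for z u D :: complex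
      using that by simp
    have "insert y J - {j} = insert y (J - {j})" using j assms(2) by auto
    moreover have "1 - c y / c j \<noteq> 0"
      using assms(2-4) j by (auto simp: inj_on_def)
    moreover have "(\<Prod>j'\<in>insert y (J - {j}). 1 - c j' / c j)
        = (1 - c y / c j) * (\<Prod>j'\<in>J - {j}. 1 - c j' / c j)"
      using assms(1,2) by (intro prod.insert) auto
    ultimately show "(1 - c y / c j) * ?T (insert y J) t j = ?T J t j"
      by (simp only: alg not_False_eq_True)
  qed
  finally show ?thesis by (simp add: residue_sum_def)
qed

lemma coeff_jump_singleton:
  assumes "c y \<noteq> 0"
  shows "coeff_jump {} d {y} c t = c y powi t"
proof -
  have zero: "coeff_jump {} d {} c t = 0" for t
    by (simp add: coeff_jump_def coeff_at_infinity_def linear_quotient_def int_coeff_def)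
  have step: "coeff_jump {} d {y} c t = c y * coeff_jump {} d {y} c (t - 1)" for t
    using coeff_jump_insert_den[of "{}" y c "{}" d t] assms zero by simp
  show ?thesis
  proof (induction t rule: int_induct[where k = 0])
    case base
    then show ?case by (simp add: coeff_jump_def coeff_at_infinity_def linear_quotient_def int_coeff_def)
  next
    case (step1 i)
    then show ?case using step[of "i + 1"] assms by (simp add: power_int_add)
  next
    case (step2 i)
    then show ?case using step[of i] assms by (simp add: power_int_diff field_simps)
  qed
qed

text \<open>With two distinct poles \<open>x\<close> and \<open>y\<close>, subtracting the recurrence that removes \<open>x\<close> from the one that
  removes \<open>y\<close> cancels the terms at \<open>t + 1\<close> and leaves \<open>(c\<^sub>x - c\<^sub>y)\<close> times the term at \<open>t\<close>. So the
  value for \<open>J\<close> is determined by the values for two smaller families, by the same rule on both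
  sides, and no initial values are needed beyond those for at most one pole.\<close>

lemma residue_sum_no_num:
  assumes "finite J" "inj_on c J" "\<And>j. j \<in> J \<Longrightarrow> c j \<noteq> 0"
  shows "residue_sum {} d J c t = coeff_jump {} d J c t"
  using assms
proof (induction J arbitrary: t rule: finite_psubset_induct)
  case (psubset J)
  show ?case
  proof (cases "\<exists>x\<in>J. \<exists>y\<in>J. x \<noteq> y")
    case False
    then consider "J = {}" | y where "J = {y}" by blast
    then show ?thesis
    proof cases
      case 1
      then show ?thesis by (simp add: residue_sum_def coeff_jump_def coeff_at_infinity_def linear_quotient_def int_coeff_def)
    next
      case 2
      then show ?thesis using psubset.prems coeff_jump_singleton[of c y d] by (simp add: residue_sum_def)
    qed
  next
    case True
    then obtain x y where xy: "x \<in> J" "y \<in> J" "x \<noteq> y" by blast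
    have ins: "insert z (J - {z}) = J" if "z \<in> J" for z using that by auto
    have IH: "residue_sum {} d (J - {z}) c s = coeff_jump {} d (J - {z}) c s" if "z \<in> J" for z s
      using that psubset.prems by (intro psubset.IH) (auto simp: inj_on_def)
    have P: "residue_sum {} d (J - {z}) c s = residue_sum {} d J c s - c z * residue_sum {} d J c (s - 1)"
      if "z \<in> J" for z s
      using residue_sum_insert_den[of "J - {z}" z c "{}" d s] that psubset.prems psubset.hyps
      unfolding ins[OF that] by simp
    have D: "coeff_jump {} d (J - {z}) c s = coeff_jump {} d J c s - c z * coeff_jump {} d J c (s - 1)"
      if "z \<in> J" for z s
      using coeff_jump_insert_den[of "J - {z}" z c "{}" d s] that psubset.prems psubset.hyps ins by simp
    have "(c x - c y) * residue_sum {} d J c t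
        = residue_sum {} d (J - {y}) c (t + 1) - residue_sum {} d (J - {x}) c (t + 1)"
      unfolding P[OF xy(1)] P[OF xy(2)] by (simp add: algebra_simps)
    also have "\<dots> = coeff_jump {} d (J - {y}) c (t + 1) - coeff_jump {} d (J - {x}) c (t + 1)"
      by (simp only: IH xy(1,2))
    also have "\<dots> = (c x - c y) * coeff_jump {} d J c t"
      unfolding D[OF xy(1)] D[OF xy(2)] by (simp add: algebra_simps)
    finally have "(c x - c y) * residue_sum {} d J c t = (c x - c y) * coeff_jump {} d J c t" .
    moreover have "c x \<noteq> c y" using xy psubset.prems by (auto simp: inj_on_def)
    ultimately show ?thesis by simp
  qed
qed

text \<open>The theorem that all residues of a rational function on the Riemann sphere, here
  \<open>f(x) x\<^bsup>-t-1\<^esup>\<close>, add up to zero.\<close>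

lemma residue_sum_eq_coeff_jump:
  assumes "finite I" "\<And>i. i \<in> I \<Longrightarrow> d i \<noteq> 0"
    and "finite J" "inj_on c J" "\<And>j. j \<in> J \<Longrightarrow> c j \<noteq> 0"
  shows "residue_sum I d J c t = coeff_jump I d J c t"
  using assms(1,2)
proof (induction I arbitrary: t rule: finite_induct)
  case empty
  then show ?case using residue_sum_no_num assms(3-5) by blast
next
  case (insert x I)
  then show ?case
    using assms(5) by (simp add: residue_sum_insert_num coeff_jump_insert_num)
qed

section \<open>Coefficients from power sums\<close>

lemma inverse_linear_factor: "inverse (1 - fps_const c * fps_X) = Abs_fps (\<lambda>n. c ^ n :: complex)"
proof (rule fps_inverse_unique)
  show "(1 - fps_const c * fps_X) * Abs_fps (\<lambda>n. c ^ n) = 1"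
  proof (rule fps_ext)
    fix n
    have e: "(1 - fps_const c * fps_X) * Abs_fps (\<lambda>n. c ^ n)
        = Abs_fps (\<lambda>n. c ^ n) - fps_const c * (fps_X * Abs_fps (\<lambda>n. c ^ n))"
      by (simp add: algebra_simps)
    show "fps_nth ((1 - fps_const c * fps_X) * Abs_fps (\<lambda>n. c ^ n)) n = fps_nth 1 n"
      unfolding e by (cases n) simp_all
  qed
qed

text \<open>Logarithmic differentiation: \<open>1 - d x\<close> contributes \<open>- d / (1 - d x)\<close>, the geometric series whose
  coefficients are powers of \<open>d\<close>.\<close>

lemma deriv_linear_quotient:
  assumes "finite I" "finite J"
  shows "fps_deriv (linear_quotient I d J c)
    = linear_quotient I d J c * Abs_fps (\<lambda>s. (\<Sum>j\<in>J. c j ^ Suc s) - (\<Sum>i\<in>I. d i ^ Suc s))"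
proof -
  let ?g = "\<lambda>x. Abs_fps (\<lambda>s. x ^ Suc s :: complex)"
  have g: "?g x = fps_const x * inverse (1 - fps_const x * fps_X)" for x
    by (rule fps_ext) (simp add: inverse_linear_factor)
  have inv: "inverse (1 - fps_const x * fps_X) * (1 - fps_const x * fps_X) = 1" for x :: complex
    by (rule inverse_mult_eq_1) simp
  have neg: "fps_deriv (u * P) = - (u * P) * (G + T)"
    if "fps_deriv u = - u * G" "fps_deriv P = - P * T" for u P G T :: "complex fps"
    using that by (simp add: algebra_simps)
  have quot: "fps_deriv (P * R) = (P * R) * (Y - T)"
    if "fps_deriv P = - P * T" "fps_deriv R = R * Y" for P R T Y :: "complex fps"
    using that by (simp add: algebra_simps)
  have num: "fps_deriv (\<Prod>i\<in>I. 1 - fps_const (d i) * fps_X)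
     = - (\<Prod>i\<in>I. 1 - fps_const (d i) * fps_X) * (\<Sum>i\<in>I. ?g (d i))"
    using assms(1)
  proof (induction I rule: finite_induct)
    case (insert x I)
    have "fps_deriv (1 - fps_const (d x) * fps_X) = - (1 - fps_const (d x) * fps_X) * ?g (d x)"
    proof -
      have alg: "- u * (v * w) = - (v * (w * u))" for u v w :: "complex fps"
        by (simp add: mult_ac)
      have "- (1 - fps_const (d x) * fps_X) * ?g (d x)
          = - (fps_const (d x) * (inverse (1 - fps_const (d x) * fps_X) * (1 - fps_const (d x) * fps_X)))"
        unfolding g by (rule alg)
      then show ?thesis unfolding inv by simp
    qed
    from neg[OF this insert.IH] show ?case
      by (simp only: prod.insert[OF insert.hyps] sum.insert[OF insert.hyps])
  qed simp
  have den: "fps_deriv (\<Prod>j\<in>J. inverse (1 - fps_const (c j) * fps_X))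
     = (\<Prod>j\<in>J. inverse (1 - fps_const (c j) * fps_X)) * (\<Sum>j\<in>J. ?g (c j))"
    using assms(2)
  proof (induction J rule: finite_induct)
    case (insert x J)
    have "fps_deriv (inverse (1 - fps_const (c x) * fps_X)) = inverse (1 - fps_const (c x) * fps_X) * ?g (c x)"
      unfolding g by (subst fps_inverse_deriv) (simp_all add: power2_eq_square mult_ac)
    with insert show ?case by (simp add: algebra_simps)
  qed simp
  have "Abs_fps (\<lambda>s. (\<Sum>j\<in>J. c j ^ Suc s) - (\<Sum>i\<in>I. d i ^ Suc s)) = (\<Sum>j\<in>J. ?g (c j)) - (\<Sum>i\<in>I. ?g (d i))"
    by (rule fps_ext) (simp add: fps_sum_nth)
  with quot[OF num den] show ?thesis
    by (simp only: linear_quotient_def)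
qed

text \<open>Newton's identities: the recursion defining \<open>newton_rec\<close> compares coefficients in
  \<open>F' = F G\<close>, where \<open>G\<close> is the logarithmic derivative, and this equation with \<open>F(0) = 1\<close> determines
  \<open>F\<close>.\<close>

lemma newton_seq_eq_coeff:
  assumes "finite I" "finite J"
    and S: "\<And>s. s \<ge> 1 \<Longrightarrow> of_nat s * S s = (\<Sum>j\<in>J. c j ^ s) - (\<Sum>i\<in>I. d i ^ s)"
  shows "newton_seq S t = int_coeff (linear_quotient I d J c) t"
proof -
  let ?F = "linear_quotient I d J c"
  have nth0: "fps_nth (prod f A) 0 = (\<Prod>x\<in>A. fps_nth (f x) 0)" for f :: "'x \<Rightarrow> complex fps" and A
    by (induction A rule: infinite_finite_induct) simp_all
  have "newton_rec S s = fps_nth ?F s" for s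
  proof (induction s rule: less_induct)
    case (less s)
    show ?case
    proof (cases s)
      case 0
      then show ?thesis by (simp add: newton_rec.simps linear_quotient_def nth0)
    next
      case (Suc u)
      have ne: "(of_nat s :: complex) \<noteq> 0" unfolding of_nat_eq_0_iff using Suc by simp
      have "of_nat s * fps_nth ?F s = fps_nth (fps_deriv ?F) u" using Suc by simp
      also have "\<dots> = (\<Sum>i=0..u. fps_nth ?F i * (of_nat (Suc (u - i)) * S (Suc (u - i))))"
        unfolding deriv_linear_quotient[OF assms(1,2)] fps_mult_nth
        by (intro sum.cong refl, subst S) simp_all
      also have "\<dots> = (\<Sum>l=1..s. of_nat l * S l * fps_nth ?F (s - l))"
        by (rule sum.reindex_bij_witness[of _ "\<lambda>l. s - l" "\<lambda>i. s - i"])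
           (auto simp: Suc Suc_diff_le)
      also have "\<dots> = (\<Sum>l=1..s. of_nat l * S l * newton_rec S (s - l))"
        using less.IH Suc by (intro sum.cong refl) simp
      also have "\<dots> = of_nat s * newton_rec S s"
        using ne by (subst newton_rec.simps[of S s]) simp
      finally show ?thesis using ne by simp
    qed
  qed
  then show ?thesis by (simp add: newton_seq_def int_coeff_def)
qed

section \<open>Oriented sums and powers of \<open>q\<close>\<close>

text \<open>For each \<open>u\<close> at least one of the two intervals is empty, so this covers both orientations without
  case distinction. In the factors of a denominator, \<open>{0..u}\<close> will index poles and \<open>{u + 1..-1}\<close>
  zeros.\<close>

lemma osum_eq: "osum c u = sum c {0..u} - sum c {u + 1..-1}"
  by (auto simp: osum_def)

lemma osum_reflect: "osum (\<lambda>j. c (u - j)) u = osum c u"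
proof -
  have "sum (\<lambda>j. c (u - j)) {0..u} = sum c {0..u}"
    by (rule sum.reindex_bij_witness[of _ "\<lambda>j. u - j" "\<lambda>j. u - j"]) auto
  moreover have "sum (\<lambda>j. c (u - j)) {u + 1..-1} = sum c {u + 1..-1}"
    by (rule sum.reindex_bij_witness[of _ "\<lambda>j. u - j" "\<lambda>j. u - j"]) auto
  ultimately show ?thesis by (simp add: osum_eq)
qed

lemma osum_step: "osum c u = osum c (u - 1) + c u"
proof (cases "u \<ge> 0")
  case True
  then have "{0..u} = insert u {0..u - 1}" by auto
  then show ?thesis using True by (simp add: osum_eq)
next
  case False
  then have "{u..-1} = insert u {u + 1..-1}" by auto
  then show ?thesis using False by (simp add: osum_eq)
qed

lemma osum_linear: "osum (\<lambda>j. x + of_int j) u = x * of_int (u + 1) + of_int (u * (u + 1)) / 2"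
proof (induction u rule: int_induct[where k = "-1"])
  case base
  then show ?case by (simp add: osum_eq)
next
  case (step1 u)
  then show ?case using osum_step[of "\<lambda>j. x + of_int j" "u + 1"] by (simp add: field_simps)
next
  case (step2 u)
  then show ?case using osum_step[of "\<lambda>j. x + of_int j" u] by (simp add: field_simps)
qed

lemma osum_one: "osum (\<lambda>_. 1) u = of_int (u + 1)"
proof (cases "u \<ge> 0")
  case True
  then show ?thesis by (simp add: osum_eq)
next
  case False
  then have "complex_of_nat (nat (- 1 - u)) = of_int (- 1 - u)" by (intro of_nat_nat) simp
  then show ?thesis using False by (simp add: osum_eq)
qed

lemma qpow_add: "qpow L (x + y) = qpow L x * qpow L y"
  by (simp add: qpow_def distrib_right exp_add)

lemma qpow_diff: "qpow L (x - y) = qpow L x / qpow L y"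
  by (simp add: qpow_def left_diff_distrib exp_diff)

lemma qpow_minus: "qpow L (- x) = inverse (qpow L x)"
  by (simp add: qpow_def exp_minus)

lemma qpow_nonzero [simp]: "qpow L x \<noteq> 0"
  by (simp add: qpow_def)

lemma qpow_of_int: "exp L = q \<Longrightarrow> qpow L (of_int j) = q powi j"
  by (auto simp: qpow_def exp_power_int)

lemma qpow_power: "qpow L x ^ s = qpow L (x * of_nat s)"
  by (simp add: qpow_def exp_of_nat_mult[symmetric] mult_ac)

lemma qpow_powi: "qpow L x powi j = qpow L (x * of_int j)"
  by (simp add: qpow_def exp_power_int mult_ac)

lemma prod_minus_qpow:
  "finite A \<Longrightarrow> (\<Prod>x\<in>A. - qpow L (e x)) = (- 1) ^ card A * qpow L (sum e A)"
  by (induction A rule: finite_induct) (simp_all add: qpow_add, simp add: qpow_def)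

lemma prod_power_int:
  "finite A \<Longrightarrow> q \<noteq> 0 \<Longrightarrow> (\<Prod>x\<in>A. q powi e x) = (q :: complex) powi sum e A"
  by (induction A rule: finite_induct) (simp_all add: power_int_add)

lemma power_int_eq_1:
  fixes q :: complex
  assumes "0 < norm q" "norm q < 1" "q powi j = 1"
  shows "j = 0"
proof -
  have *: "i = 0" if "i \<ge> 0" "q powi i = 1" for i
  proof (rule ccontr)
    assume "i \<noteq> 0"
    have "norm q ^ nat i = 1"
      using that by (metis norm_one norm_power power_int_def)
    moreover have "norm q ^ nat i < 1"
      using assms(1,2) that \<open>i \<noteq> 0\<close> by (intro power_less_one_iff[THEN iffD2]) auto
    ultimately show False by simp
  qed
  have "q powi (- j) = 1" using assms(3) by (simp add: power_int_minus)
  with *[of j] *[of "- j"] assms(3) show ?thesis by linarith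
qed

section \<open>Shifted factorials\<close>

text \<open>The multiplicative counterpart of \<open>osum_eq\<close>. For \<open>N < 0\<close> it remains true when factors in the
  denominator vanish, since both sides are then \<open>0\<close>.\<close>

lemma qpoch_int_prod:
  "qpoch q a N = (\<Prod>j\<in>{0..N-1}. 1 - a * q powi j) / (\<Prod>j\<in>{N..-1}. 1 - a * q powi j)"
proof (cases "N \<ge> 0")
  case True
  have "(\<Prod>j<nat N. 1 - a * q ^ j) = (\<Prod>j\<in>{0..N-1}. 1 - a * q powi j)"
    by (rule prod.reindex_bij_witness[of _ nat int]) auto
  then show ?thesis using True by (simp add: qpoch_def)
next
  case False
  have "(\<Prod>j=1..nat (- N). 1 - a / q ^ j) = (\<Prod>j\<in>{N..-1}. 1 - a * q powi j)"
    by (rule prod.reindex_bij_witness[of _ "\<lambda>j. nat (- j)" "\<lambda>j. - int j"])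
       (auto simp: power_int_minus field_simps)
  then show ?thesis using False by (simp add: qpoch_def prod_dividef)
qed

lemma qpoch_0 [simp]: "qpoch q a 0 = 1"
  by (simp add: qpoch_def)

lemma qpoch_Suc: "qpoch q a (int (Suc s)) = qpoch q a (int s) * (1 - a * q ^ s)"
  by (simp add: qpoch_def del: of_nat_Suc)

text \<open>Replacing \<open>y\<close> by \<open>y/q\<close> shifts the window of exponents by one: one factor enters and one leaves. The
  relations are stated without division, so that they hold also where these factors vanish; for
  \<open>N < 0\<close> it is the reciprocal that is a polynomial in \<open>y\<close>.\<close>

lemma qpoch_div_q:
  assumes "q \<noteq> 0" "N \<ge> 0"
  shows "qpoch q (y / q) N * (1 - y * q powi (N - 1)) = (1 - y / q) * qpoch q y N"
proof -
  let ?f = "\<lambda>j. 1 - y * q powi j"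
  have "(\<Prod>j\<in>{0..N-1}. 1 - y / q * q powi j) = (\<Prod>j\<in>{-1..N-2}. ?f j)"
    using assms(1)
    by (intro prod.reindex_bij_witness[of _ "\<lambda>j. j + 1" "\<lambda>j. j - 1"]) (auto simp: power_int_diff)
  moreover have "?f (-1) * prod ?f {0..N-1} = ?f (N-1) * prod ?f {-1..N-2}"
  proof -
    have "?f (-1) * prod ?f {0..N-1} = prod ?f (insert (-1) {0..N-1})" by simp
    also have "insert (-1) {0..N-1} = insert (N-1) {-1..N-2}" using assms(2) by auto
    also have "prod ?f \<dots> = ?f (N-1) * prod ?f {-1..N-2}" by simp
    finally show ?thesis .
  qed
  ultimately show ?thesis using assms(2) by (simp add: qpoch_int_prod power_int_minus field_simps)
qed

lemma inverse_qpoch_div_q: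
  assumes "q \<noteq> 0" "N < 0"
  shows "inverse (qpoch q (y / q) N) * (1 - y / q) = (1 - y * q powi (N - 1)) * inverse (qpoch q y N)"
proof -
  let ?f = "\<lambda>j. 1 - y * q powi j"
  have "(\<Prod>j\<in>{N..-1}. 1 - y / q * q powi j) = (\<Prod>j\<in>{N-1..-2}. ?f j)"
    using assms(1)
    by (intro prod.reindex_bij_witness[of _ "\<lambda>j. j + 1" "\<lambda>j. j - 1"]) (auto simp: power_int_diff)
  moreover have "?f (-1) * prod ?f {N-1..-2} = ?f (N-1) * prod ?f {N..-1}"
  proof -
    have "?f (-1) * prod ?f {N-1..-2} = prod ?f (insert (-1) {N-1..-2})" by simp
    also have "insert (-1) {N-1..-2} = insert (N-1) {N..-1}" using assms(2) by auto
    also have "prod ?f \<dots> = ?f (N-1) * prod ?f {N..-1}" by simp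
    finally show ?thesis .
  qed
  ultimately show ?thesis using assms(2) by (simp add: qpoch_int_prod power_int_minus field_simps)
qed

text \<open>Iterating the one-step shift moves the argument from \<open>q\<^bsup>a\<^sub>i\<^esup>\<close> to the pole \<open>q\<^bsup>a\<^sub>i-s\<^esup>\<close>. The
  factors that enter and leave, read backwards, are the shifted factorials of length \<open>s\<close> that occur
  in the hypergeometric series; the powers of \<open>q\<close> that come from reversing them combine to
  \<open>q\<^bsup>Ns\<^esup>\<close>.\<close>

lemma qpoch_shift:
  assumes "q \<noteq> 0" "y \<noteq> 0" "N \<ge> 0"
  shows "qpoch q (y / q ^ s) N * qpoch q (q powi (1 - N) / y) (int s) * q powi (N * int s)
       = qpoch q y N * qpoch q (q / y) (int s)"
proof (induction s)
  case (Suc s)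
  have step: "qpoch q (y / q ^ Suc s) N * (1 - y / q ^ s * q powi (N - 1))
      = (1 - y / q ^ Suc s) * qpoch q (y / q ^ s) N"
    using qpoch_div_q[OF assms(1,3), of "y / q ^ s"] by (simp add: mult.commute)
  have f: "q powi N * (1 - q powi (1 - N) / y * q ^ s) = - (q ^ Suc s / y) * (1 - y / q ^ s * q powi (N - 1))"
    using assms(1,2) by (simp add: power_int_diff field_simps)
  have g: "- (q ^ Suc s / y) * (1 - y / q ^ Suc s) = 1 - q / y * q ^ s"
    using assms(1,2) by (simp add: field_simps)
  have p: "q powi (N * int (Suc s)) = q powi (N * int s) * q powi N"
    using assms(1) by (simp add: distrib_left power_int_add)
  have "qpoch q (y / q ^ Suc s) N * qpoch q (q powi (1 - N) / y) (int (Suc s)) * q powi (N * int (Suc s))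
      = qpoch q (y / q ^ Suc s) N * (q powi N * (1 - q powi (1 - N) / y * q ^ s))
         * qpoch q (q powi (1 - N) / y) (int s) * q powi (N * int s)"
    unfolding qpoch_Suc p by (simp only: mult_ac)
  also have "\<dots> = - (q ^ Suc s / y) * (qpoch q (y / q ^ Suc s) N * (1 - y / q ^ s * q powi (N - 1)))
         * qpoch q (q powi (1 - N) / y) (int s) * q powi (N * int s)"
    unfolding f by (simp only: mult_ac)
  also have "\<dots> = (- (q ^ Suc s / y) * (1 - y / q ^ Suc s))
         * (qpoch q (y / q ^ s) N * qpoch q (q powi (1 - N) / y) (int s) * q powi (N * int s))"
    unfolding step by (simp only: mult_ac)
  also have "\<dots> = qpoch q y N * qpoch q (q / y) (int (Suc s))"
    unfolding g Suc.IH qpoch_Suc by (simp only: mult_ac)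
  finally show ?case .
qed simp

lemma inverse_qpoch_shift:
  assumes "q \<noteq> 0" "y \<noteq> 0" "N < 0"
  shows "inverse (qpoch q (y / q ^ s) N) * qpoch q (q / y) (int s)
       = inverse (qpoch q y N) * qpoch q (q powi (1 - N) / y) (int s) * q powi (N * int s)"
proof (induction s)
  case (Suc s)
  have step: "inverse (qpoch q (y / q ^ Suc s) N) * (1 - y / q ^ Suc s)
      = (1 - y / q ^ s * q powi (N - 1)) * inverse (qpoch q (y / q ^ s) N)"
    using inverse_qpoch_div_q[OF assms(1,3), of "y / q ^ s"] by (simp add: mult.commute)
  have f: "- (q ^ Suc s / y) * (1 - y / q ^ s * q powi (N - 1)) = q powi N * (1 - q powi (1 - N) / y * q ^ s)"
    using assms(1,2) by (simp add: power_int_diff field_simps)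
  have g: "1 - q / y * q ^ s = - (q ^ Suc s / y) * (1 - y / q ^ Suc s)"
    using assms(1,2) by (simp add: field_simps)
  have p: "q powi (N * int (Suc s)) = q powi (N * int s) * q powi N"
    using assms(1) by (simp add: distrib_left power_int_add)
  have "inverse (qpoch q (y / q ^ Suc s) N) * qpoch q (q / y) (int (Suc s))
      = - (q ^ Suc s / y) * (inverse (qpoch q (y / q ^ Suc s) N) * (1 - y / q ^ Suc s)) * qpoch q (q / y) (int s)"
    unfolding qpoch_Suc g by (simp only: mult_ac)
  also have "\<dots> = (- (q ^ Suc s / y) * (1 - y / q ^ s * q powi (N - 1)))
       * (inverse (qpoch q (y / q ^ s) N) * qpoch q (q / y) (int s))"
    unfolding step by (simp only: mult_ac)
  also have "\<dots> = inverse (qpoch q y N) * qpoch q (q powi (1 - N) / y) (int (Suc s)) * q powi (N * int (Suc s))"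
    unfolding f Suc.IH qpoch_Suc p by (simp only: mult_ac)
  finally show ?case .
qed simp

text \<open>The form used for denominators. For \<open>N \<ge> 0\<close>, \<open>qpoch_shift\<close> also shows that the shifted factorial
  of length \<open>N\<close> stays nonzero: a factor that vanished after the shift would already occur in one of
  the two factorials assumed to be nonzero.\<close>

lemma inverse_qpoch_shift_ratio:
  assumes "q \<noteq> 0" "y \<noteq> 0" "qpoch q y N \<noteq> 0" "qpoch q (q / y) (int s) \<noteq> 0"
  shows "inverse (qpoch q (y / q ^ s) N)
       = inverse (qpoch q y N) * (qpoch q (q powi (1 - N) / y) (int s) / qpoch q (q / y) (int s)) * q powi (N * int s)"
proof (cases "N \<ge> 0")
  case True
  have e: "qpoch q (y / q ^ s) N * qpoch q (q powi (1 - N) / y) (int s) * q powi (N * int s)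
       = qpoch q y N * qpoch q (q / y) (int s)"
    using qpoch_shift[OF assms(1,2) True] .
  then have "qpoch q (y / q ^ s) N \<noteq> 0" using assms(3,4) by auto
  with e show ?thesis using assms(3,4) by (simp add: divide_simps mult_ac)
next
  case False
  have alg: "u = v * (A / B) * z" if "u * B = v * A * z" "B \<noteq> 0" for u v A B z :: complex
    using that(1)[symmetric] that(2) by (simp add: field_simps)
  show ?thesis
    using False by (intro alg inverse_qpoch_shift assms(1,2,4)) simp
qed

lemma qpoch_q_nonzero:
  assumes "0 < norm q" "norm q < 1"
  shows "qpoch q q (int s) \<noteq> 0"
proof (induction s)
  case (Suc s)
  have "q * q ^ s \<noteq> 1"
    using power_int_eq_1[OF assms, of "int (Suc s)"] by (auto simp del: of_nat_Suc)
  with Suc show ?case unfolding qpoch_Suc by simp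
qed simp

lemma qpoch_terminating_zero:
  assumes "q \<noteq> 0" "0 \<le> K" "int s > K"
  shows "qpoch q (q powi (- K)) (int s) = 0"
proof -
  have "q powi (- K) * q ^ nat K = q powi (- K + K)"
    using assms(1,2) by (subst power_int_add) (simp_all add: power_int_def)
  then have "q powi (- K) * q ^ nat K = 1" by simp
  moreover have "nat K < s" using assms(2,3) by linarith
  ultimately show ?thesis by (auto simp: qpoch_def)
qed

text \<open>The analogue of \<open>qpoch_shift\<close> for the factors whose poles lie in the progression of the pole
  itself. The window of exponents \<open>{-s..K-s}\<close> now contains \<open>0\<close>, whose factor is the one that
  vanishes at the pole and has to be left out.\<close>

lemma own_pole_product:
  assumes "q \<noteq> 0" "int s \<le> K"
  shows "(\<Prod>j\<in>{0..K} - {int s}. 1 - q powi (j - int s)) * qpoch q (q powi (- K)) (int s)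
            * q powi ((K + 1) * int s)
       = qpoch q q K * qpoch q q (int s)"
  using assms(2)
proof (induction s)
  case 0
  have "(\<Prod>j\<in>{0..K} - {0}. 1 - q powi j) = (\<Prod>j\<in>{0..K-1}. 1 - q * q powi j)"
    using assms(1) by (intro prod.reindex_bij_witness[of _ "\<lambda>j. j + 1" "\<lambda>j. j - 1"])
      (auto simp: power_int_diff)
  with 0 show ?case by (simp add: qpoch_int_prod)
next
  case (Suc s)
  let ?f = "\<lambda>j. 1 - q powi j"
  have G: "(\<Prod>j\<in>{0..K} - {int u}. 1 - q powi (j - int u)) = prod ?f ({- int u..K - int u} - {0})" for u
    by (intro prod.reindex_bij_witness[of _ "\<lambda>j. j + int u" "\<lambda>j. j - int u"]) auto
  have "?f (K - int s) * prod ?f ({- int (Suc s)..K - int (Suc s)} - {0})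
      = prod ?f (insert (K - int s) ({- int (Suc s)..K - int (Suc s)} - {0}))"
    by simp
  also have "insert (K - int s) ({- int (Suc s)..K - int (Suc s)} - {0})
      = insert (- int (Suc s)) ({- int s..K - int s} - {0})"
    using Suc.prems by auto
  also have "prod ?f \<dots> = ?f (- int (Suc s)) * prod ?f ({- int s..K - int s} - {0})"
    by simp
  finally have step: "?f (K - int s) * prod ?f ({- int (Suc s)..K - int (Suc s)} - {0})
      = ?f (- int (Suc s)) * prod ?f ({- int s..K - int s} - {0})" .
  have f: "q powi (K + 1) * (1 - q powi (- K) * q ^ s) = - (q ^ Suc s) * ?f (K - int s)"
    using assms(1) by (simp add: power_int_diff power_int_add power_int_minus field_simps)
  have g: "- (q ^ Suc s) * ?f (- int (Suc s)) = 1 - q * q ^ s"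
    using assms(1) by (simp add: power_int_minus field_simps del: of_nat_Suc)
  have p: "q powi ((K + 1) * int (Suc s)) = q powi ((K + 1) * int s) * q powi (K + 1)"
    using assms(1) by (simp add: distrib_left power_int_add)
  have "prod ?f ({- int (Suc s)..K - int (Suc s)} - {0}) * qpoch q (q powi (- K)) (int (Suc s))
            * q powi ((K + 1) * int (Suc s))
     = prod ?f ({- int (Suc s)..K - int (Suc s)} - {0}) * (q powi (K + 1) * (1 - q powi (- K) * q ^ s))
         * qpoch q (q powi (- K)) (int s) * q powi ((K + 1) * int s)"
    unfolding qpoch_Suc p by (simp only: mult_ac)
  also have "\<dots> = - (q ^ Suc s) * (?f (K - int s) * prod ?f ({- int (Suc s)..K - int (Suc s)} - {0}))
         * qpoch q (q powi (- K)) (int s) * q powi ((K + 1) * int s)"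
    unfolding f by (simp only: mult_ac)
  also have "\<dots> = (- (q ^ Suc s) * ?f (- int (Suc s)))
      * (prod ?f ({- int s..K - int s} - {0}) * qpoch q (q powi (- K)) (int s) * q powi ((K + 1) * int s))"
    unfolding step by (simp only: mult_ac)
  also have "\<dots> = qpoch q q K * qpoch q q (int (Suc s))"
    using Suc unfolding g qpoch_Suc G by (simp add: mult_ac)
  finally show ?case unfolding G .
qed

section \<open>The rational function behind the identity\<close>

text \<open>For \<open>K\<^sub>i \<ge> 0\<close>, the quotient of \<open>\<Prod>\<^sub>i (q\<^bsup>1-b\<^sub>i\<^esup> x; q)\<^bsub>K\<^sub>i\<^esub>\<close> by \<open>\<Prod>\<^sub>i (q\<^bsup>-a\<^sub>i\<^esup> x; q)\<^bsub>U\<^sub>i+1\<^esub>\<close> is a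
  quotient of products of linear factors \<open>1 - q\<^sup>e x\<close>. A denominator of negative length contributes
  factors to the numerator; they form the second summand of \<open>zero_index\<close>.\<close>

definition zero_index :: "nat \<Rightarrow> (nat \<Rightarrow> int) \<Rightarrow> (nat \<Rightarrow> int) \<Rightarrow> (nat \<times> int + nat \<times> int) set" where
  "zero_index r K U = (SIGMA i:{1..r}. {0..K i - 1}) <+> (SIGMA i:{1..r}. {U i + 1..-1})"

definition pole_index :: "nat \<Rightarrow> (nat \<Rightarrow> int) \<Rightarrow> (nat \<times> int) set" where
  "pole_index r U = (SIGMA i:{1..r}. {0..U i})"

definition pole_exp :: "(nat \<Rightarrow> complex) \<Rightarrow> nat \<times> int \<Rightarrow> complex" where
  "pole_exp a = (\<lambda>(i, j). - a i + of_int j)"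

definition zero_exp :: "(nat \<Rightarrow> complex) \<Rightarrow> (nat \<Rightarrow> complex) \<Rightarrow> nat \<times> int + nat \<times> int \<Rightarrow> complex" where
  "zero_exp a b = case_sum (\<lambda>(i, j). 1 - b i + of_int j) (pole_exp a)"

lemma finite_zero_pole_index [simp]: "finite (zero_index r K U)" "finite (pole_index r U)"
  by (auto simp: zero_index_def pole_index_def)

text \<open>Counted with sign, the linear factors are exactly what oriented sums run over. Instances of
  \<open>h\<close> give the power sums \<open>P\<close> and \<open>Q\<close>, the degree, and the exponent of the leading coefficient.\<close>

lemma sum_zeros_minus_poles:
  fixes h :: "complex \<Rightarrow> complex"
  assumes "\<And>i. i \<in> {1..r} \<Longrightarrow> K i \<ge> 0"
  shows "(\<Sum>x\<in>zero_index r K U. h (zero_exp a b x)) - (\<Sum>x\<in>pole_index r U. h (pole_exp a x))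
    = (\<Sum>i=1..r. osum (\<lambda>j. h (1 - b i + of_int j)) (K i - 1) - osum (\<lambda>j. h (- a i + of_int j)) (U i))"
proof -
  have 1: "(\<Sum>x\<in>zero_index r K U. h (zero_exp a b x))
      = (\<Sum>i=1..r. \<Sum>j\<in>{0..K i - 1}. h (1 - b i + of_int j))
        + (\<Sum>i=1..r. \<Sum>j\<in>{U i + 1..-1}. h (- a i + of_int j))"
    unfolding zero_index_def by (simp add: sum.Plus sum.Sigma zero_exp_def pole_exp_def split_def o_def)
  have 2: "(\<Sum>x\<in>pole_index r U. h (pole_exp a x)) = (\<Sum>i=1..r. \<Sum>j\<in>{0..U i}. h (- a i + of_int j))"
    unfolding pole_index_def by (simp add: sum.Sigma pole_exp_def split_def)
  have 3: "osum c (K i - 1) = sum c {0..K i - 1}" if "i \<in> {1..r}" for i c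
    using assms[OF that] by (simp add: osum_def)
  show ?thesis
    unfolding 1 2 by (simp add: 3 osum_eq[of _ "U _"] sum_subtractf sum.distrib)
qed

lemma prod_zeros:
  fixes h :: "complex \<Rightarrow> complex"
  shows "(\<Prod>x\<in>zero_index r K U. h (zero_exp a b x))
      = (\<Prod>i=1..r. \<Prod>j\<in>{0..K i - 1}. h (1 - b i + of_int j))
        * (\<Prod>i=1..r. \<Prod>j\<in>{U i + 1..-1}. h (- a i + of_int j))"
  unfolding zero_index_def by (simp add: prod.Plus prod.Sigma zero_exp_def pole_exp_def split_def o_def)

lemma prod_other_poles:
  fixes h :: "complex \<Rightarrow> complex"
  assumes "i \<in> {1..r}"
  shows "(\<Prod>x\<in>pole_index r U - {(i, s)}. h (pole_exp a x))
      = (\<Prod>l\<in>{1..r} - {i}. \<Prod>j\<in>{0..U l}. h (- a l + of_int j))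
        * (\<Prod>j\<in>{0..U i} - {s}. h (- a i + of_int j))"
proof -
  have "pole_index r U - {(i, s)} = (SIGMA l:{1..r} - {i}. {0..U l}) \<union> (SIGMA l:{i}. {0..U l} - {s})"
    using assms by (auto simp: pole_index_def)
  moreover have "(\<Prod>x\<in>(SIGMA l:{1..r} - {i}. {0..U l}) \<union> (SIGMA l:{i}. {0..U l} - {s}). h (pole_exp a x))
     = (\<Prod>x\<in>(SIGMA l:{1..r} - {i}. {0..U l}). h (pole_exp a x)) * (\<Prod>x\<in>(SIGMA l:{i}. {0..U l} - {s}). h (pole_exp a x))"
    by (rule prod.union_disjoint) auto
  moreover have "(\<Prod>x\<in>(SIGMA l:{1..r} - {i}. {0..U l}). h (pole_exp a x))
     = (\<Prod>l\<in>{1..r} - {i}. \<Prod>j\<in>{0..U l}. h (- a l + of_int j))"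
    by (simp add: prod.Sigma pole_exp_def split_def)
  moreover have "(\<Prod>x\<in>(SIGMA l:{i}. {0..U l} - {s}). h (pole_exp a x)) = (\<Prod>j\<in>{0..U i} - {s}. h (- a i + of_int j))"
    by (rule prod.reindex_bij_witness[of _ "Pair i" snd]) (auto simp: pole_exp_def)
  ultimately show ?thesis by simp
qed

lemma newton_seq_P_sum:
  assumes "\<And>i. i \<in> {1..r} \<Longrightarrow> k + m i \<ge> 0"
  shows "newton_seq (P_sum L r k a b m n) t
    = int_coeff (linear_quotient (zero_index r (\<lambda>i. k + m i) (\<lambda>i. k + n i)) (\<lambda>x. qpow L (zero_exp a b x))
        (pole_index r (\<lambda>i. k + n i)) (\<lambda>x. qpow L (pole_exp a x))) t"
proof (rule newton_seq_eq_coeff)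
  fix s :: nat assume "s \<ge> 1"
  have "of_nat s * P_sum L r k a b m n s
     = (\<Sum>i=1..r. osum (\<lambda>j. qpow L ((- a i + of_int j) * of_nat s)) (k + n i)
           - osum (\<lambda>j. qpow L ((1 - b i + of_int j) * of_nat s)) (k + m i - 1))"
    using \<open>s \<ge> 1\<close> by (simp add: P_sum_def)
  also have "\<dots> = - (\<Sum>i=1..r. osum (\<lambda>j. qpow L (1 - b i + of_int j) ^ s) (k + m i - 1)
           - osum (\<lambda>j. qpow L (- a i + of_int j) ^ s) (k + n i))"
    by (simp add: qpow_power sum_subtractf)
  also have "\<dots> = (\<Sum>x\<in>pole_index r (\<lambda>i. k + n i). qpow L (pole_exp a x) ^ s)
     - (\<Sum>x\<in>zero_index r (\<lambda>i. k + m i) (\<lambda>i. k + n i). qpow L (zero_exp a b x) ^ s)"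
    using assms
    by (subst sum_zeros_minus_poles[of r "\<lambda>i. k + m i" "\<lambda>z. qpow L z ^ s" a b "\<lambda>i. k + n i", symmetric])
       simp_all
  finally show "of_nat s * P_sum L r k a b m n s
     = (\<Sum>x\<in>pole_index r (\<lambda>i. k + n i). qpow L (pole_exp a x) ^ s)
     - (\<Sum>x\<in>zero_index r (\<lambda>i. k + m i) (\<lambda>i. k + n i). qpow L (zero_exp a b x) ^ s)" .
qed simp_all

text \<open>\<open>Q_sum\<close> lists the inverted parameters of each progression in the opposite direction, whence
  \<open>osum_reflect\<close>.\<close>

lemma newton_seq_Q_sum:
  assumes "\<And>i. i \<in> {1..r} \<Longrightarrow> k + m i \<ge> 0"
  shows "newton_seq (Q_sum L r k a b m n) t
    = int_coeff (linear_quotient (zero_index r (\<lambda>i. k + m i) (\<lambda>i. k + n i)) (\<lambda>x. inverse (qpow L (zero_exp a b x)))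
        (pole_index r (\<lambda>i. k + n i)) (\<lambda>x. inverse (qpow L (pole_exp a x)))) t"
proof (rule newton_seq_eq_coeff)
  fix s :: nat assume "s \<ge> 1"
  have "of_nat s * Q_sum L r k a b m n s
     = (\<Sum>i=1..r. osum (\<lambda>j. qpow L ((a i - of_int (n i) - of_int k + of_int j) * of_nat s)) (k + n i)
           - osum (\<lambda>j. qpow L ((b i - of_int (m i) - of_int k + of_int j) * of_nat s)) (k + m i - 1))"
    using \<open>s \<ge> 1\<close> by (simp add: Q_sum_def)
  also have "\<dots> = (\<Sum>i=1..r. osum (\<lambda>j. inverse (qpow L (- a i + of_int (k + n i - j))) ^ s) (k + n i)
           - osum (\<lambda>j. inverse (qpow L (1 - b i + of_int (k + m i - 1 - j))) ^ s) (k + m i - 1))"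
    by (simp add: qpow_power qpow_minus[symmetric] algebra_simps)
  also have "\<dots> = - (\<Sum>i=1..r. osum (\<lambda>j. inverse (qpow L (1 - b i + of_int j)) ^ s) (k + m i - 1)
           - osum (\<lambda>j. inverse (qpow L (- a i + of_int j)) ^ s) (k + n i))"
    unfolding osum_reflect[of "\<lambda>j. inverse (qpow L (- a _ + of_int j)) ^ s"]
      osum_reflect[of "\<lambda>j. inverse (qpow L (1 - b _ + of_int j)) ^ s"]
    by (simp add: sum_subtractf)
  also have "\<dots> = (\<Sum>x\<in>pole_index r (\<lambda>i. k + n i). inverse (qpow L (pole_exp a x)) ^ s)
     - (\<Sum>x\<in>zero_index r (\<lambda>i. k + m i) (\<lambda>i. k + n i). inverse (qpow L (zero_exp a b x)) ^ s)"
    using assms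
    by (subst sum_zeros_minus_poles[of r "\<lambda>i. k + m i" "\<lambda>z. inverse (qpow L z) ^ s" a b "\<lambda>i. k + n i", symmetric])
       simp_all
  finally show "of_nat s * Q_sum L r k a b m n s
     = (\<Sum>x\<in>pole_index r (\<lambda>i. k + n i). inverse (qpow L (pole_exp a x)) ^ s)
     - (\<Sum>x\<in>zero_index r (\<lambda>i. k + m i) (\<lambda>i. k + n i). inverse (qpow L (zero_exp a b x)) ^ s)" .
qed simp_all

lemma zeros_minus_poles_count:
  assumes "\<And>i. i \<in> {1..r} \<Longrightarrow> k + m i \<ge> 0"
  shows "int (card (zero_index r (\<lambda>i. k + m i) (\<lambda>i. k + n i))) - int (card (pole_index r (\<lambda>i. k + n i)))
    = (\<Sum>i=1..r. m i) - (\<Sum>i=1..r. n i) - int r"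
proof -
  let ?I = "zero_index r (\<lambda>i. k + m i) (\<lambda>i. k + n i)" and ?J = "pole_index r (\<lambda>i. k + n i)"
  have "complex_of_int (int (card ?I) - int (card ?J)) = (\<Sum>x\<in>?I. 1) - (\<Sum>x\<in>?J. 1)"
    by simp
  also have "\<dots> = (\<Sum>i=1..r. osum (\<lambda>_. 1) (k + m i - 1) - osum (\<lambda>_. 1) (k + n i))"
    using sum_zeros_minus_poles[of r "\<lambda>i. k + m i" "\<lambda>_. 1" a b "\<lambda>i. k + n i" for a b] assms
    by simp
  also have "\<dots> = (\<Sum>i=1..r. of_int (m i - n i - 1))"
    by (intro sum.cong refl) (simp add: osum_one)
  also have "\<dots> = complex_of_int ((\<Sum>i=1..r. m i) - (\<Sum>i=1..r. n i) - int r)"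
    by (simp add: sum_subtractf)
  finally show ?thesis unfolding of_int_eq_iff .
qed

text \<open>The exponent is a sum of arithmetic progressions; by \<open>osum_linear\<close> each is a polynomial in \<open>k\<close>,
  \<open>m\<^sub>i\<close>, \<open>n\<^sub>i\<close>, and the terms with \<open>k\<^sup>2\<close> cancel between zeros and poles.\<close>

lemma leading_coefficient:
  fixes a b :: "nat \<Rightarrow> complex" and m n :: "nat \<Rightarrow> int"
  assumes "\<And>i. i \<in> {1..r} \<Longrightarrow> k + m i \<ge> 0"
  defines "M \<equiv> \<Sum>i=1..r. m i" and "N \<equiv> \<Sum>i=1..r. n i"
  shows "(\<Prod>x\<in>zero_index r (\<lambda>i. k + m i) (\<lambda>i. k + n i). - qpow L (zero_exp a b x))
      / (\<Prod>x\<in>pole_index r (\<lambda>i. k + n i). - qpow L (pole_exp a x))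
    = (- 1) powi (M - N - int r)
      * qpow L (of_int k * ((\<Sum>i=1..r. a i) - (\<Sum>i=1..r. b i) + of_int (M - N)))
      * qpow L ((\<Sum>i=1..r. a i) + (\<Sum>i=1..r. a i * of_int (n i)) - (\<Sum>i=1..r. b i * of_int (m i))
          + of_int ((\<Sum>i=1..r. (m i)\<^sup>2) - (\<Sum>i=1..r. (n i)\<^sup>2) + M - N) / 2)"
proof -
  let ?I = "zero_index r (\<lambda>i. k + m i) (\<lambda>i. k + n i)" and ?J = "pole_index r (\<lambda>i. k + n i)"
  have "(\<Sum>x\<in>?I. zero_exp a b x) - (\<Sum>x\<in>?J. pole_exp a x)
     = (\<Sum>i=1..r. osum (\<lambda>j. 1 - b i + of_int j) (k + m i - 1) - osum (\<lambda>j. - a i + of_int j) (k + n i))"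
    using sum_zeros_minus_poles[of r "\<lambda>i. k + m i" "\<lambda>z. z" a b "\<lambda>i. k + n i"] assms(1) by simp
  also have "\<dots> = (\<Sum>i=1..r. of_int k * (a i - b i + (of_int (m i) - of_int (n i)))
     + (a i + a i * of_int (n i) - b i * of_int (m i)
        + ((of_int (m i))\<^sup>2 - (of_int (n i))\<^sup>2 + of_int (m i) - of_int (n i)) / 2))"
    unfolding osum_linear by (intro sum.cong refl) (simp add: field_simps power2_eq_square)
  also have "\<dots> = of_int k * ((\<Sum>i=1..r. a i) - (\<Sum>i=1..r. b i) + of_int (M - N))
      + ((\<Sum>i=1..r. a i) + (\<Sum>i=1..r. a i * of_int (n i)) - (\<Sum>i=1..r. b i * of_int (m i))
          + of_int ((\<Sum>i=1..r. (m i)\<^sup>2) - (\<Sum>i=1..r. (n i)\<^sup>2) + M - N) / 2)"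
    by (simp add: M_def N_def sum.distrib sum_subtractf sum_distrib_left[symmetric] sum_divide_distrib[symmetric])
  finally have e: "(\<Sum>x\<in>?I. zero_exp a b x) - (\<Sum>x\<in>?J. pole_exp a x) = \<dots>" .
  have deg: "M - N - int r = int (card ?I) - int (card ?J)"
    unfolding M_def N_def using assms(1) by (intro zeros_minus_poles_count[symmetric])
  have s: "(-1) ^ card ?I / (-1) ^ card ?J = (-1 :: complex) powi (M - N - int r)"
    unfolding deg by (simp add: power_int_diff)
  have "(\<Prod>x\<in>?I. - qpow L (zero_exp a b x)) / (\<Prod>x\<in>?J. - qpow L (pole_exp a x))
     = ((-1) ^ card ?I / (-1) ^ card ?J) * qpow L ((\<Sum>x\<in>?I. zero_exp a b x) - (\<Sum>x\<in>?J. pole_exp a x))"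
    by (simp add: prod_minus_qpow qpow_diff)
  then show ?thesis unfolding e s qpow_add[of L "of_int k * _"] by (simp only: mult.assoc)
qed

section \<open>The hypergeometric terms as residues\<close>

lemma qpoch_eq_0:
  assumes "0 \<le> e" "e < N" "x * q powi e = 1"
  shows "qpoch q x N = 0"
proof -
  have "(\<Prod>j\<in>{0..N-1}. 1 - x * q powi j) = 0"
    using assms by (intro prod_zero) (auto intro!: bexI[of _ e])
  then show ?thesis unfolding qpoch_int_prod by (simp only: div_0)
qed

lemma prod_list_comprehension:
  "(\<Prod>d\<leftarrow>[f l. l \<leftarrow> [1..<r + 1]]. h d) = (\<Prod>l=1..r. h (f l) :: complex)"
  "(\<Prod>d\<leftarrow>[f l. l \<leftarrow> [1..<r + 1], l \<noteq> i]. h d) = (\<Prod>l\<in>{1..r} - {i}. h (f l) :: complex)"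
proof -
  show "(\<Prod>d\<leftarrow>[f l. l \<leftarrow> [1..<r + 1]]. h d) = (\<Prod>l=1..r. h (f l))"
    by (simp add: o_def prod.distinct_set_conv_list[symmetric] atLeastLessThanSuc_atLeastAtMost del: upt_Suc)
  have "[f l. l \<leftarrow> xs, l \<noteq> i] = map f (filter (\<lambda>l. l \<noteq> i) xs)" for xs
    by (induction xs) simp_all
  then have "(\<Prod>d\<leftarrow>[f l. l \<leftarrow> [1..<r + 1], l \<noteq> i]. h d) = (\<Prod>l\<leftarrow>filter (\<lambda>l. l \<noteq> i) [1..<r + 1]. h (f l))"
    by (simp only: map_map o_def)
  also have "\<dots> = (\<Prod>l\<in>set (filter (\<lambda>l. l \<noteq> i) [1..<r + 1]). h (f l))"
    by (rule prod.distinct_set_conv_list[symmetric]) simp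
  also have "set (filter (\<lambda>l. l \<noteq> i) [1..<r + 1]) = {1..r} - {i}" by auto
  finally show "(\<Prod>d\<leftarrow>[f l. l \<leftarrow> [1..<r + 1], l \<noteq> i]. h d) = (\<Prod>l\<in>{1..r} - {i}. h (f l))" .
qed

lemma length_comprehension:
  assumes "i \<in> {1..r}"
  shows "length [f l. l \<leftarrow> [1..<r + 1], l \<noteq> i] = r - 1"
proof -
  have "[f l. l \<leftarrow> xs, l \<noteq> i] = map f (filter (\<lambda>l. l \<noteq> i) xs)" for xs
    by (induction xs) simp_all
  then have "length [f l. l \<leftarrow> [1..<r + 1], l \<noteq> i] = length (filter (\<lambda>l. l \<noteq> i) [1..<r + 1])"
    by (simp only: length_map)
  also have "\<dots> = card (set (filter (\<lambda>l. l \<noteq> i) [1..<r + 1]))"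
    by (rule distinct_card[symmetric]) simp
  also have "set (filter (\<lambda>l. l \<noteq> i) [1..<r + 1]) = {1..r} - {i}" by auto
  also have "card \<dots> = r - 1" using assms by simp
  finally show ?thesis .
qed

text \<open>The parameter \<open>q\<^bsup>-k-n\<^sub>i\<^esup>\<close> terminates the series, and since there is exactly one upper parameter
  more than there are lower ones, the factor \<open>(-1)\<^sup>s q\<^bsup>s(s-1)/2\<^esup>\<close> occurs to the power \<open>0\<close>.\<close>

lemma hypergeometric_finite_sum:
  assumes "0 < norm q" "norm q < 1" "exp L = q" "i \<in> {1..r}" "k + n i \<ge> 0"
  shows "basic_hypergeometric q (upper_params L r k a b n i) (lower_params L r k a b m i) z
    = (\<Sum>s\<le>nat (k + n i).
         qpoch q (q powi (- (k + n i))) (int s)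
         * (\<Prod>l=1..r. qpoch q (qpow L (b l - a i)) (int s))
         * (\<Prod>l\<in>{1..r} - {i}. qpoch q (qpow L (a l - a i - of_int (n l) - of_int k)) (int s))
         / ((\<Prod>l=1..r. qpoch q (qpow L (b l - a i - of_int (m l) - of_int k)) (int s))
            * (\<Prod>l\<in>{1..r} - {i}. qpoch q (qpow L (1 - a i + a l)) (int s)) * qpoch q q (int s)) * z ^ s)"
proof -
  have q: "q \<noteq> 0" using assms(1) by auto
  have len: "1 + length (lower_params L r k a b m i) - length (upper_params L r k a b n i) = 0"
    unfolding lower_params_def upper_params_def list.size length_append length_map length_upt
      length_comprehension[OF assms(4)]
    using assms(4) by simp
  have up: "(\<Prod>c\<leftarrow>upper_params L r k a b n i. h c)
     = h (q powi (- (k + n i))) * (\<Prod>l=1..r. h (qpow L (b l - a i)))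
         * (\<Prod>l\<in>{1..r} - {i}. h (qpow L (a l - a i - of_int (n l) - of_int k)))" for h :: "complex \<Rightarrow> complex"
  proof -
    have "qpow L (of_int (- k - n i)) = q powi (- (k + n i))"
      unfolding qpow_of_int[OF assms(3)] by simp
    then show ?thesis
      unfolding upper_params_def list.map map_append prod_list.Cons prod_list.append prod_list_comprehension
      by (simp only: mult.assoc)
  qed
  have lo: "(\<Prod>c\<leftarrow>lower_params L r k a b m i. h c)
     = (\<Prod>l=1..r. h (qpow L (b l - a i - of_int (m l) - of_int k)))
            * (\<Prod>l\<in>{1..r} - {i}. h (qpow L (1 - a i + a l)))" for h :: "complex \<Rightarrow> complex"
    unfolding lower_params_def map_append prod_list.append prod_list_comprehension ..
  show ?thesis
    unfolding basic_hypergeometric_def len up lo power_0 mult_1_right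
  proof (rule suminf_finite)
    fix s assume "s \<notin> {..nat (k + n i)}"
    then have "int s > k + n i" by simp
    with qpoch_terminating_zero[OF q assms(5)] 
    have "qpoch q (q powi (- (k + n i))) (int s) = 0" by blast
    then show "qpoch q (q powi (- (k + n i))) (int s)
         * (\<Prod>l=1..r. qpoch q (qpow L (b l - a i)) (int s))
         * (\<Prod>l\<in>{1..r} - {i}. qpoch q (qpow L (a l - a i - of_int (n l) - of_int k)) (int s))
         / ((\<Prod>l=1..r. qpoch q (qpow L (b l - a i - of_int (m l) - of_int k)) (int s))
            * (\<Prod>l\<in>{1..r} - {i}. qpoch q (qpow L (1 - a i + a l)) (int s)) * qpoch q q (int s)) * z ^ s = 0"
      by simp
  qed simp
qed

text \<open>At the pole \<open>x = q\<^bsup>a\<^sub>i-s\<^esup>\<close> the linear factors regroup into shifted factorials, one for each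
  progression. For \<open>l \<noteq> i\<close> the poles and zeros of the \<open>l\<close>-th denominator together form the
  reciprocal of one shifted factorial, whatever the sign of its length.\<close>

lemma integrand_at_pole:
  fixes a b :: "nat \<Rightarrow> complex" and m n :: "nat \<Rightarrow> int"
  assumes L: "exp L = q" and i: "i \<in> {1..r}" and s: "int s \<le> k + n i"
    and K: "\<And>l. l \<in> {1..r} \<Longrightarrow> k + m l \<ge> 0"
  defines "c \<equiv> qpow L (pole_exp a (i, int s))"
  shows "(\<Prod>x\<in>zero_index r (\<lambda>l. k + m l) (\<lambda>l. k + n l). 1 - qpow L (zero_exp a b x) / c)
      / (\<Prod>x\<in>pole_index r (\<lambda>l. k + n l) - {(i, int s)}. 1 - qpow L (pole_exp a x) / c)
    = (\<Prod>l=1..r. qpoch q (qpow L (1 - b l + a i) / q ^ s) (m l + k))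
      * (\<Prod>l\<in>{1..r} - {i}. inverse (qpoch q (qpow L (a i - a l) / q ^ s) (n l + k + 1)))
      / (\<Prod>j\<in>{0..k + n i} - {int s}. 1 - q powi (j - int s))"
proof -
  have q: "q \<noteq> 0" using L by auto
  have c: "c = q ^ s / qpow L (a i)"
    using qpow_of_int[OF L, of "int s"]
    unfolding c_def pole_exp_def prod.case qpow_add qpow_minus by (simp add: field_simps)
  have quot: "qpow L (x + of_int j) / c = qpow L (x + a i) / q ^ s * q powi j" for x j
    unfolding c qpow_add qpow_of_int[OF L] by simp
  have num: "(\<Prod>j\<in>{0..k + m l - 1}. 1 - qpow L (1 - b l + of_int j) / c)
      = qpoch q (qpow L (1 - b l + a i) / q ^ s) (m l + k)" if "l \<in> {1..r}" for l
    using K[OF that] unfolding qpoch_int_prod quot by (simp add: add.commute)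
  have den: "(\<Prod>j\<in>{k + n l + 1..-1}. 1 - qpow L (- a l + of_int j) / c)
        / (\<Prod>j\<in>{0..k + n l}. 1 - qpow L (- a l + of_int j) / c)
      = inverse (qpoch q (qpow L (a i - a l) / q ^ s) (n l + k + 1))" for l
    unfolding qpoch_int_prod quot by (simp add: add.commute)
  have own: "1 - qpow L (- a i + of_int j) / c = 1 - q powi (j - int s)" for j
    unfolding quot using q by (simp add: power_int_diff qpow_def)
  have empty: "(\<Prod>j\<in>{k + n i + 1..-1}. 1 - qpow L (- a i + of_int j) / c) = 1"
    using s by simp
  have "(\<Prod>l=1..r. \<Prod>j\<in>{k + n l + 1..-1}. 1 - qpow L (- a l + of_int j) / c)
      = (\<Prod>l\<in>{1..r} - {i}. \<Prod>j\<in>{k + n l + 1..-1}. 1 - qpow L (- a l + of_int j) / c)"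
    using i by (subst prod.remove[of _ i]) (simp_all only: finite_atLeastAtMost empty mult_1)
  then show ?thesis
    unfolding prod_zeros[where h = "\<lambda>z. 1 - qpow L z / c"]
      prod_other_poles[OF i, where h = "\<lambda>z. 1 - qpow L z / c"] den[symmetric] own prod_dividef
    by (simp add: num)
qed

text \<open>Shifting every factorial from \<open>q\<^bsup>a\<^sub>i-s\<^esup>\<close> back to \<open>q\<^bsup>a\<^sub>i\<^esup>\<close> produces the prefactor times the
  \<open>s\<close>-th term of the series. The powers of \<open>q\<close> collected on the way, together with the one from
  \<open>x\<^bsup>1-t\<^esup>\<close>, make up the argument \<open>q\<^bsup>N-M+r-1+t\<^esup>\<close> of the series.\<close>

lemma residue_eq_series_term:
  fixes a b :: "nat \<Rightarrow> complex" and m n :: "nat \<Rightarrow> int"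
  assumes q: "0 < norm q" "norm q < 1" and L: "exp L = q" and i: "i \<in> {1..r}" and s: "int s \<le> k + n i"
    and K: "\<And>l. l \<in> {1..r} \<Longrightarrow> k + m l \<ge> 0"
    and den: "\<And>l. l \<in> {1..r} - {i} \<Longrightarrow> qpoch q (qpow L (a i - a l)) (n l + k + 1) \<noteq> 0"
    and lo1: "\<And>l. l \<in> {1..r} \<Longrightarrow> qpoch q (qpow L (b l - a i - of_int (m l) - of_int k)) (int s) \<noteq> 0"
    and lo2: "\<And>l. l \<in> {1..r} - {i} \<Longrightarrow> qpoch q (qpow L (1 - a i + a l)) (int s) \<noteq> 0"
  defines "c \<equiv> qpow L (pole_exp a (i, int s))"
    and "e \<equiv> (\<Sum>l=1..r. n l) - (\<Sum>l=1..r. m l) + int r"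
  shows "c powi (t - 1) * (\<Prod>x\<in>zero_index r (\<lambda>l. k + m l) (\<lambda>l. k + n l). 1 - qpow L (zero_exp a b x) / c)
      / (\<Prod>x\<in>pole_index r (\<lambda>l. k + n l) - {(i, int s)}. 1 - qpow L (pole_exp a x) / c)
    = qpow L (a i * (1 - of_int t)) * (\<Prod>l=1..r. qpoch q (qpow L (1 - b l + a i)) (m l + k))
         / (qpoch q q (k + n i) * (\<Prod>l\<in>{1..r} - {i}. qpoch q (qpow L (a i - a l)) (n l + k + 1)))
      * (qpoch q (q powi (- (k + n i))) (int s)
         * (\<Prod>l=1..r. qpoch q (qpow L (b l - a i)) (int s))
         * (\<Prod>l\<in>{1..r} - {i}. qpoch q (qpow L (a l - a i - of_int (n l) - of_int k)) (int s))
         / ((\<Prod>l=1..r. qpoch q (qpow L (b l - a i - of_int (m l) - of_int k)) (int s))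
            * (\<Prod>l\<in>{1..r} - {i}. qpoch q (qpow L (1 - a i + a l)) (int s)) * qpoch q q (int s))
         * (qpow L (of_int (e - 1 + t))) ^ s)"
proof -
  have q0: "q \<noteq> 0" using L by auto
  have q1: "qpow L 1 = q" using L by (simp add: qpow_def)
  have num: "qpoch q (qpow L (1 - b l + a i) / q ^ s) (m l + k)
      = qpoch q (qpow L (1 - b l + a i)) (m l + k)
        * (qpoch q (qpow L (b l - a i)) (int s) / qpoch q (qpow L (b l - a i - of_int (m l) - of_int k)) (int s))
        * q powi (- (m l + k) * int s)" if l: "l \<in> {1..r}" for l
  proof -
    have "q powi (1 - (m l + k)) / qpow L (1 - b l + a i) = qpow L (b l - a i - of_int (m l) - of_int k)"
      unfolding qpow_of_int[OF L, symmetric] qpow_diff[symmetric] by (simp add: algebra_simps)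
    moreover have "q / qpow L (1 - b l + a i) = qpow L (b l - a i)"
      unfolding q1[symmetric] qpow_diff[symmetric] by (simp add: algebra_simps)
    moreover have "m l + k \<ge> 0" using K[OF l] by simp
    ultimately have "qpoch q (qpow L (1 - b l + a i) / q ^ s) (m l + k)
        * qpoch q (qpow L (b l - a i - of_int (m l) - of_int k)) (int s) * q powi ((m l + k) * int s)
      = qpoch q (qpow L (1 - b l + a i)) (m l + k) * qpoch q (qpow L (b l - a i)) (int s)"
      using qpoch_shift[of q "qpow L (1 - b l + a i)" "m l + k" s] q0 by simp
    moreover have "q powi (- (m l + k) * int s) = inverse (q powi ((m l + k) * int s))"
      by (simp only: minus_mult_left[symmetric] power_int_minus)
    moreover have "u = v * (A / B) * w" if "u * B * z = v * A" "w = inverse z" "B \<noteq> 0" "z \<noteq> 0"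
      for u v A B z w :: complex
      using that(1)[symmetric] that(2-4) by (simp add: field_simps)
    moreover have "q powi ((m l + k) * int s) \<noteq> 0" using q0 by simp
    ultimately show ?thesis
      using lo1[OF l] by blast
  qed
  have inv: "inverse (qpoch q (qpow L (a i - a l) / q ^ s) (n l + k + 1))
      = inverse (qpoch q (qpow L (a i - a l)) (n l + k + 1))
        * (qpoch q (qpow L (a l - a i - of_int (n l) - of_int k)) (int s) / qpoch q (qpow L (1 - a i + a l)) (int s))
        * q powi ((n l + k + 1) * int s)" if l: "l \<in> {1..r} - {i}" for l
  proof -
    have "q powi (1 - (n l + k + 1)) / qpow L (a i - a l) = qpow L (a l - a i - of_int (n l) - of_int k)"
      unfolding qpow_of_int[OF L, symmetric] qpow_diff[symmetric] by (simp add: algebra_simps)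
    moreover have "q / qpow L (a i - a l) = qpow L (1 - a i + a l)"
      unfolding q1[symmetric] qpow_diff[symmetric] by (simp add: algebra_simps)
    ultimately show ?thesis
      using inverse_qpoch_shift_ratio[of q "qpow L (a i - a l)" "n l + k + 1" s] q0 den[OF l] lo2[OF l] by simp
  qed
  have own: "inverse (\<Prod>j\<in>{0..k + n i} - {int s}. 1 - q powi (j - int s))
      = qpoch q (q powi (- (k + n i))) (int s) * q powi ((n i + k + 1) * int s)
         / (qpoch q q (k + n i) * qpoch q q (int s))"
  proof -
    have "qpoch q q (k + n i) \<noteq> 0"
      using qpoch_q_nonzero[OF q, of "nat (k + n i)"] s by simp
    moreover have "(\<Prod>j\<in>{0..k + n i} - {int s}. 1 - q powi (j - int s)) * qpoch q (q powi (- (k + n i))) (int s)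
            * q powi ((n i + k + 1) * int s) = qpoch q q (k + n i) * qpoch q q (int s)"
      using own_pole_product[OF q0 s] by (simp add: add_ac)
    moreover have "inverse G = A * z / (B * C)" if "B \<noteq> 0" "C \<noteq> 0" "G * A * z = B * C" for G A z B C :: complex
    proof -
      have "G \<noteq> 0" using that by auto
      then show ?thesis using that by (simp add: field_simps)
    qed
    ultimately show ?thesis using qpoch_q_nonzero[OF q] by blast
  qed
  have powers: "q powi (\<Sum>l=1..r. - (m l + k) * int s) * q powi (\<Sum>l\<in>{1..r} - {i}. (n l + k + 1) * int s)
       * q powi ((n i + k + 1) * int s) * c powi (t - 1)
     = qpow L (a i * (1 - of_int t)) * (qpow L (of_int (e - 1 + t))) ^ s"
  proof -
    have "(\<Sum>l=1..r. - (m l + k) * int s) + (\<Sum>l\<in>{1..r} - {i}. (n l + k + 1) * int s) + (n i + k + 1) * int s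
      = (\<Sum>l=1..r. - (m l + k) * int s) + (\<Sum>l=1..r. (n l + k + 1) * int s)"
      using i by (simp add: sum.remove[of _ i "\<lambda>l. (n l + k + 1) * int s"])
    also have "\<dots> = e * int s"
      unfolding sum_distrib_right[symmetric] e_def
      by (simp add: sum.distrib sum_negf algebra_simps sum_subtractf)
    finally have E: "q powi (\<Sum>l=1..r. - (m l + k) * int s) * q powi (\<Sum>l\<in>{1..r} - {i}. (n l + k + 1) * int s)
       * q powi ((n i + k + 1) * int s) = q powi (e * int s)"
      using q0 by (simp add: power_int_add[symmetric])
    have "q powi (e * int s) * c powi (t - 1) = qpow L (of_int (e * int s) + (- a i + of_nat s) * of_int (t - 1))"
      unfolding c_def pole_exp_def qpow_of_int[OF L, symmetric] by (simp add: qpow_powi qpow_add)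
    also have "of_int (e * int s) + (- a i + of_nat s) * of_int (t - 1)
        = a i * (1 - of_int t) + of_int (e - 1 + t) * of_nat s"
      by (simp add: algebra_simps)
    finally show ?thesis unfolding E qpow_power qpow_add .
  qed
  have shape: "ct * (W * (X1 / X2) * z1 * (Y * (Z1 / Z2) * z2) * (T * z3 / (Q1 * Q2)))
      = pa * W / (Q1 * inverse Y) * (T * X1 * Z1 / (X2 * Z2 * Q2) * zs)"
    if "z1 * z2 * z3 * ct = pa * zs" for ct W X1 X2 z1 Y Z1 Z2 z2 T z3 Q1 Q2 pa zs :: complex
  proof -
    have "ct * (W * (X1 / X2) * z1 * (Y * (Z1 / Z2) * z2) * (T * z3 / (Q1 * Q2)))
       = (z1 * z2 * z3 * ct) * (W * (X1 / X2) * Y * (Z1 / Z2) * T / (Q1 * Q2))"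
      by (simp add: mult_ac)
    then show ?thesis unfolding that by (simp add: divide_inverse mult_ac)
  qed
  have "c powi (t - 1) * (\<Prod>x\<in>zero_index r (\<lambda>l. k + m l) (\<lambda>l. k + n l). 1 - qpow L (zero_exp a b x) / c)
      / (\<Prod>x\<in>pole_index r (\<lambda>l. k + n l) - {(i, int s)}. 1 - qpow L (pole_exp a x) / c)
     = c powi (t - 1) * ((\<Prod>l=1..r. qpoch q (qpow L (1 - b l + a i) / q ^ s) (m l + k))
      * (\<Prod>l\<in>{1..r} - {i}. inverse (qpoch q (qpow L (a i - a l) / q ^ s) (n l + k + 1)))
      * inverse (\<Prod>j\<in>{0..k + n i} - {int s}. 1 - q powi (j - int s)))"
  proof -
    have "x * y / z = x * (u * v * inverse w)" if "y / z = u * v / w" for x y z u v w :: complex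
      unfolding times_divide_eq_right[symmetric] that by (simp add: divide_inverse)
    then show ?thesis unfolding c_def using integrand_at_pole[of L q i r s k n m a b] L i s K by blast
  qed
  also have "\<dots> = c powi (t - 1) *
      ((\<Prod>l=1..r. qpoch q (qpow L (1 - b l + a i)) (m l + k))
        * ((\<Prod>l=1..r. qpoch q (qpow L (b l - a i)) (int s))
           / (\<Prod>l=1..r. qpoch q (qpow L (b l - a i - of_int (m l) - of_int k)) (int s)))
        * q powi (\<Sum>l=1..r. - (m l + k) * int s)
      * ((\<Prod>l\<in>{1..r} - {i}. inverse (qpoch q (qpow L (a i - a l)) (n l + k + 1)))
        * ((\<Prod>l\<in>{1..r} - {i}. qpoch q (qpow L (a l - a i - of_int (n l) - of_int k)) (int s))
           / (\<Prod>l\<in>{1..r} - {i}. qpoch q (qpow L (1 - a i + a l)) (int s)))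
        * q powi (\<Sum>l\<in>{1..r} - {i}. (n l + k + 1) * int s))
      * (qpoch q (q powi (- (k + n i))) (int s) * q powi ((n i + k + 1) * int s)
         / (qpoch q q (k + n i) * qpoch q q (int s))))"
    using prod.cong[OF refl num, of "{1..r}"] prod.cong[OF refl inv, of "{1..r} - {i}"]
    by (simp only: own prod.distrib prod_dividef prod_power_int[OF _ q0] finite_atLeastAtMost finite_Diff)
  also have "\<dots> = qpow L (a i * (1 - of_int t)) * (\<Prod>l=1..r. qpoch q (qpow L (1 - b l + a i)) (m l + k))
         / (qpoch q q (k + n i) * inverse (\<Prod>l\<in>{1..r} - {i}. inverse (qpoch q (qpow L (a i - a l)) (n l + k + 1))))
      * (qpoch q (q powi (- (k + n i))) (int s)
         * (\<Prod>l=1..r. qpoch q (qpow L (b l - a i)) (int s))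
         * (\<Prod>l\<in>{1..r} - {i}. qpoch q (qpow L (a l - a i - of_int (n l) - of_int k)) (int s))
         / ((\<Prod>l=1..r. qpoch q (qpow L (b l - a i - of_int (m l) - of_int k)) (int s))
            * (\<Prod>l\<in>{1..r} - {i}. qpoch q (qpow L (1 - a i + a l)) (int s)) * qpoch q q (int s))
         * (qpow L (of_int (e - 1 + t))) ^ s)"
    by (rule shape[OF powers])
  finally show ?thesis by (simp only: prod_inversef[unfolded o_def] inverse_inverse_eq)
qed

section \<open>The identity\<close>

text \<open>The residues at the poles in the \<open>i\<close>-th progression add up to the \<open>i\<close>-th summand on the left, so
  \<open>residue_sum_eq_coeff_jump\<close> evaluates the left-hand side. It has to be checked that the
  poles are distinct, and this is where the assumptions on vanishing denominators enter a second
  time.\<close>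

theorem proposition2:
  fixes q L :: complex and r :: nat
    and a b :: "nat \<Rightarrow> complex" and m n :: "nat \<Rightarrow> int" and t k p M N M2 N2 :: int
    and A B adotn bdotm :: complex
  assumes "r \<ge> 2"
    and "0 < norm q" and "norm q < 1" and "exp L = q"
    and "\<And>i j. 1 \<le> i \<Longrightarrow> i < j \<Longrightarrow> j \<le> r \<Longrightarrow> a i - a j \<notin> \<int>"
    and "A = (\<Sum>i=1..r. a i)" and "B = (\<Sum>i=1..r. b i)"
    and "M = (\<Sum>i=1..r. m i)" and "N = (\<Sum>i=1..r. n i)"
    and "M2 = (\<Sum>i=1..r. (m i)\<^sup>2)" and "N2 = (\<Sum>i=1..r. (n i)\<^sup>2)"
    and "adotn = (\<Sum>i=1..r. a i * of_int (n i))" and "bdotm = (\<Sum>i=1..r. b i * of_int (m i))"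
    and "p = max (-1) (M - N - int r - t + 1)"
    and "k \<ge> - Min (m ` {1..r})"
    \<comment> \<open>no vanishing denominators in the terms that occur on the left-hand side\<close>
    and "\<And>i l. i \<in> {1..r} \<Longrightarrow> k + n i \<ge> 0 \<Longrightarrow> l \<in> {1..r} - {i} \<Longrightarrow>
           qpoch q (qpow L (a i - a l)) (n l + k + 1) \<noteq> 0"
    and "\<And>i d j. i \<in> {1..r} \<Longrightarrow> d \<in> set (lower_params L r k a b m i) \<Longrightarrow> 0 \<le> j \<Longrightarrow> j \<le> k + n i \<Longrightarrow>
           qpoch q d j \<noteq> 0"
  shows
    "(\<Sum>i\<in>{1..r}.
        if k + n i < 0 then 0
        else qpow L (a i * (1 - of_int t)) * (\<Prod>l=1..r. qpoch q (qpow L (1 - b l + a i)) (m l + k))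
             / (qpoch q q (k + n i)
                * (\<Prod>l\<in>{1..r} - {i}. qpoch q (qpow L (a i - a l)) (n l + k + 1)))
             * basic_hypergeometric q (upper_params L r k a b n i) (lower_params L r k a b m i)
                 (qpow L (of_int (N - M + int r - 1 + t))))
     = (-1) powi (M - N - int r + 1) * qpow L (of_int k * (A - B + of_int (M - N)))
         * qpow L (A + adotn - bdotm + of_int (M2 - N2 + M - N) / 2)
         * newton_seq (Q_sum L r k a b m n) p
       + newton_seq (P_sum L r k a b m n) (t - 1)"
proof -
  note q = assms(2,3) and L = assms(4) and den = assms(16) and low = assms(17)
  have q0: "q \<noteq> 0" using assms(2) by auto
  have K: "k + m l \<ge> 0" if "l \<in> {1..r}" for l
  proof -
    have "Min (m ` {1..r}) \<le> m l" using that by (intro Min_le) auto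
    then show ?thesis using assms(15) by linarith
  qed
  have low1: "qpoch q (qpow L (b l - a i - of_int (m l) - of_int k)) j \<noteq> 0"
    if "i \<in> {1..r}" "l \<in> {1..r}" "0 \<le> j" "j \<le> k + n i" for i l j
    using that by (intro low[of i]) (auto simp: lower_params_def simp del: upt_Suc)
  have low2: "qpoch q (qpow L (1 - a i + a l)) j \<noteq> 0"
    if "i \<in> {1..r}" "l \<in> {1..r} - {i}" "0 \<le> j" "j \<le> k + n i" for i l j
    using that by (intro low[of i]) (auto simp: lower_params_def simp del: upt_Suc)
  let ?I = "zero_index r (\<lambda>i. k + m i) (\<lambda>i. k + n i)" and ?J = "pole_index r (\<lambda>i. k + n i)"
  let ?d = "\<lambda>x. qpow L (zero_exp a b x)" and ?c = "\<lambda>x. qpow L (pole_exp a x)"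
  have cq: "?c (i, j) = q powi j / qpow L (a i)" for i j
    unfolding pole_exp_def prod.case qpow_add qpow_minus qpow_of_int[OF L] by (simp add: field_simps)
  have inj: "inj_on ?c ?J"
  proof (rule inj_onI)
    fix x x' assume x: "x \<in> ?J" and x': "x' \<in> ?J" and eq: "?c x = ?c x'"
    obtain i j l j' where xx: "x = (i, j)" "x' = (l, j')" by (metis surj_pair)
    have ij: "i \<in> {1..r}" "0 \<le> j" "j \<le> k + n i" "l \<in> {1..r}" "0 \<le> j'" "j' \<le> k + n l"
      using x x' unfolding xx pole_index_def by auto
    define y where "y = qpow L (a i - a l)"
    have y: "y * q powi (j' - j) = 1"
      using eq q0 unfolding xx cq y_def by (simp add: qpow_diff power_int_diff field_simps)
    \<comment> \<open>Coinciding poles of different progressions would make one of the linear factors vanish: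
      a factor of \<open>(q\<^bsup>a\<^sub>i-a\<^sub>l\<^esup>; q)\<^bsub>n\<^sub>l+k+1\<^esub>\<close> if \<open>j' \<ge> j\<close>, and a factor of
      \<open>(q\<^bsup>1-a\<^sub>i+a\<^sub>l\<^esup>; q)\<^bsub>k+n\<^sub>i\<^esub>\<close> if \<open>j' < j\<close>.\<close>
    show "x = x'"
    proof (cases "i = l")
      case True
      then have "q powi (j' - j) = 1" using y by (simp add: y_def qpow_def)
      from power_int_eq_1[OF q this] True show ?thesis by (simp add: xx)
    next
      case False
      show ?thesis
      proof (cases "j' \<ge> j")
        case True
        then have "qpoch q y (n l + k + 1) = 0"
          using ij by (intro qpoch_eq_0[OF _ _ y]) auto
        then show ?thesis using den[of i l] ij False by (simp add: y_def)
      next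
        case less: False
        have "qpow L (1 - a i + a l) * q powi (j - j' - 1) = inverse (y * q powi (j' - j))"
          using q0 qpow_of_int[OF L, of 1] unfolding y_def
          by (simp add: qpow_diff qpow_add power_int_diff power_int_add field_simps)
        then have "qpow L (1 - a i + a l) * q powi (j - j' - 1) = 1" unfolding y by simp
        then have "qpoch q (qpow L (1 - a i + a l)) (k + n i) = 0"
          using ij less by (intro qpoch_eq_0[of "j - j' - 1"]) auto
        then show ?thesis using low2[of i l "k + n i"] ij False by simp
      qed
    qed
  qed
  have term_i: "(\<Sum>j\<in>{0..k + n i}. ?c (i, j) powi (t - 1) * (\<Prod>x\<in>?I. 1 - ?d x / ?c (i, j))
        / (\<Prod>x\<in>?J - {(i, j)}. 1 - ?c x / ?c (i, j)))
      = (if k + n i < 0 then 0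
        else qpow L (a i * (1 - of_int t)) * (\<Prod>l=1..r. qpoch q (qpow L (1 - b l + a i)) (m l + k))
             / (qpoch q q (k + n i)
                * (\<Prod>l\<in>{1..r} - {i}. qpoch q (qpow L (a i - a l)) (n l + k + 1)))
             * basic_hypergeometric q (upper_params L r k a b n i) (lower_params L r k a b m i)
                 (qpow L (of_int (N - M + int r - 1 + t))))" (is "sum ?F _ = _") if i: "i \<in> {1..r}" for i
  proof (cases "k + n i < 0")
    case False
    then have U: "k + n i \<ge> 0" by simp
    have "sum ?F {0..k + n i} = (\<Sum>s\<le>nat (k + n i). ?F (int s))"
      using U by (intro sum.reindex_bij_witness[of _ int nat]) auto
    also have "\<dots> = (\<Sum>s\<le>nat (k + n i).
         qpow L (a i * (1 - of_int t)) * (\<Prod>l=1..r. qpoch q (qpow L (1 - b l + a i)) (m l + k))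
         / (qpoch q q (k + n i) * (\<Prod>l\<in>{1..r} - {i}. qpoch q (qpow L (a i - a l)) (n l + k + 1)))
      * (qpoch q (q powi (- (k + n i))) (int s)
         * (\<Prod>l=1..r. qpoch q (qpow L (b l - a i)) (int s))
         * (\<Prod>l\<in>{1..r} - {i}. qpoch q (qpow L (a l - a i - of_int (n l) - of_int k)) (int s))
         / ((\<Prod>l=1..r. qpoch q (qpow L (b l - a i - of_int (m l) - of_int k)) (int s))
            * (\<Prod>l\<in>{1..r} - {i}. qpoch q (qpow L (1 - a i + a l)) (int s)) * qpoch q q (int s))
         * (qpow L (of_int (N - M + int r - 1 + t))) ^ s))"
    proof (rule sum.cong[OF refl])
      fix s assume "s \<in> {..nat (k + n i)}"
      then have s: "int s \<le> k + n i" using U by auto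
      show "?F (int s) = qpow L (a i * (1 - of_int t)) * (\<Prod>l=1..r. qpoch q (qpow L (1 - b l + a i)) (m l + k))
         / (qpoch q q (k + n i) * (\<Prod>l\<in>{1..r} - {i}. qpoch q (qpow L (a i - a l)) (n l + k + 1)))
      * (qpoch q (q powi (- (k + n i))) (int s)
         * (\<Prod>l=1..r. qpoch q (qpow L (b l - a i)) (int s))
         * (\<Prod>l\<in>{1..r} - {i}. qpoch q (qpow L (a l - a i - of_int (n l) - of_int k)) (int s))
         / ((\<Prod>l=1..r. qpoch q (qpow L (b l - a i - of_int (m l) - of_int k)) (int s))
            * (\<Prod>l\<in>{1..r} - {i}. qpoch q (qpow L (1 - a i + a l)) (int s)) * qpoch q q (int s))
         * (qpow L (of_int (N - M + int r - 1 + t))) ^ s)"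
        unfolding assms(8,9)
      proof (rule residue_eq_series_term[where k = k and n = n and m = m and a = a and b = b, OF q L i s])
        show "0 \<le> k + m l" if "l \<in> {1..r}" for l using K[OF that] .
        show "qpoch q (qpow L (a i - a l)) (n l + k + 1) \<noteq> 0" if "l \<in> {1..r} - {i}" for l
          using den[OF i U that] .
        show "qpoch q (qpow L (b l - a i - of_int (m l) - of_int k)) (int s) \<noteq> 0" if "l \<in> {1..r}" for l
          using low1[OF i that _ s] by simp
        show "qpoch q (qpow L (1 - a i + a l)) (int s) \<noteq> 0" if "l \<in> {1..r} - {i}" for l
          using low2[OF i that _ s] by simp
      qed
    qed
    finally show ?thesis
      using False unfolding hypergeometric_finite_sum[of q L i r k n, OF q L i U] sum_distrib_left[symmetric] by simp
  qed simp
  have "(\<Sum>i\<in>{1..r}.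
        if k + n i < 0 then 0
        else qpow L (a i * (1 - of_int t)) * (\<Prod>l=1..r. qpoch q (qpow L (1 - b l + a i)) (m l + k))
             / (qpoch q q (k + n i)
                * (\<Prod>l\<in>{1..r} - {i}. qpoch q (qpow L (a i - a l)) (n l + k + 1)))
             * basic_hypergeometric q (upper_params L r k a b n i) (lower_params L r k a b m i)
                 (qpow L (of_int (N - M + int r - 1 + t)))) = residue_sum ?I ?d ?J ?c (t - 1)"
    (is "?lhs = _")
  proof -
    have "residue_sum ?I ?d ?J ?c (t - 1)
       = (\<Sum>i\<in>{1..r}. \<Sum>j\<in>{0..k + n i}. ?c (i, j) powi (t - 1) * (\<Prod>x\<in>?I. 1 - ?d x / ?c (i, j))
        / (\<Prod>x\<in>?J - {(i, j)}. 1 - ?c x / ?c (i, j)))"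
      unfolding residue_sum_def by (subst (1) pole_index_def, subst sum.Sigma) (simp_all add: split_def)
    then show ?thesis using sum.cong[OF refl term_i, of "{1..r}"] by simp
  qed
  also have "\<dots> = coeff_jump ?I ?d ?J ?c (t - 1)"
    using inj by (intro residue_sum_eq_coeff_jump) simp_all
  also have "\<dots> = newton_seq (P_sum L r k a b m n) (t - 1)
      - (\<Prod>x\<in>?I. - ?d x) / (\<Prod>x\<in>?J. - ?c x)
        * newton_seq (Q_sum L r k a b m n) (int (card ?I) - int (card ?J) - (t - 1))"
    unfolding coeff_jump_def coeff_at_infinity_def
    using newton_seq_P_sum[of r k m, OF K] newton_seq_Q_sum[of r k m, OF K] by simp
  also have "int (card ?I) - int (card ?J) - (t - 1) = M - N - int r - t + 1"
    using zeros_minus_poles_count[of r k m n, OF K] assms(8,9) by simp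
  \<comment> \<open>\<open>newton_seq\<close> is \<open>0\<close> at every negative index, so cutting the index off at \<open>-1\<close> changes
    nothing.\<close>
  also have "newton_seq (Q_sum L r k a b m n) (M - N - int r - t + 1) = newton_seq (Q_sum L r k a b m n) p"
    unfolding assms(14) by (simp add: newton_seq_def max_def)
  also have "(\<Prod>x\<in>?I. - ?d x) / (\<Prod>x\<in>?J. - ?c x)
     = (- 1) powi (M - N - int r) * qpow L (of_int k * (A - B + of_int (M - N)))
      * qpow L (A + adotn - bdotm + of_int (M2 - N2 + M - N) / 2)"
    unfolding assms(6-13) by (rule leading_coefficient[of r k m, OF K])
  \<comment> \<open>The minus sign in front of the expansion at infinity accounts for the final \<open>+ 1\<close> in the
    exponent of \<open>-1\<close>.\<close>
  also have "(- 1 :: complex) powi (M - N - int r) = - ((- 1) powi (M - N - int r + 1))"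
    by (subst power_int_add) simp_all
  finally show ?thesis by simp
qed

end
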